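(* There is an absolute constant $C>0$ such that for every integer $\ell\ge 3$, with $n=\ell(\ell-1)/2$, there exists a set $U_n$ of at most $C\,n\log n$ points, each having integer coordinates $(x,y)$ with $1\le x\le \kappa_{\max}(\ell)$ and $1\le y\le C\ell$, such that $U_n$ is a universal point set for the $n$-vertex pseudoline arrangement graphs: every pseudoline arrangement graph with $n$ vertices has a planar straight-line drawing whose vertices are placed at distinct points of $U_n$.
   Context: A pseudoline is the image of a straight line under a homeomorphism of the plane onto itself. An arrangement of pseudolines is a finite set of pseudolines every two of which meet in exactly one point, which is a crossing (a point near which the two pseudolines look, up to homeomorphism, like two crossing lines); it is simple if distinct pairs have distinct crossing points. A pseudoline arrangement graph has the crossings of a simple pseudoline arrangement as vertices and edges between crossings consecutive along a common pseudoline; with $\ell$ pseudolines it has $\ell(\ell-1)/2$ vertices. A universal point set for a class of $n$-vertex graphs is a point set $U$ in the plane such that every graph in the class admits a straight-line drawing without edge crossings with its vertices mapped injectively into $U$. A wiring diagram $\mathcal D$ with $\ell$ pseudolines is a simple pseudoline arrangement in which the pseudolines lie on the horizontal tracks $y=1,\dots,\ell$ except near crossings at pairwise distinct $x$-coordinates, where the two pseudolines on adjacent tracks $i,i+1$ swap tracks. The $i$-th level $L_{\mathcal D}(i)$ is the set of crossings between tracks $i$ and $i+1$; $\kappa(\mathcal D)=\max_i|L_{\mathcal D}(i)|$, and $\kappa_{\max}(\ell)$ is the maximum of $\kappa(\mathcal D)$ over all wiring diagrams with $\ell$ pseudolines. *)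

theory Defs
  imports "HOL-Analysis.Analysis"
begin

type_synonym point = "real \<times> real"

definition xaxis :: "point set" where
  "xaxis = {z. snd z = 0}"

definition pseudoline :: "point set \<Rightarrow> bool" where
  "pseudoline P \<longleftrightarrow> (\<exists>h h'. homeomorphism UNIV UNIV h h' \<and> P = h ` xaxis)"

definition is_crossing :: "point set \<Rightarrow> point set \<Rightarrow> point \<Rightarrow> bool" where
  "is_crossing P Q p \<longleftrightarrow> p \<in> P \<and> p \<in> Q \<and>
     (\<exists>W (\<phi>::point \<Rightarrow> point) \<psi>. open W \<and> p \<in> W \<and> homeomorphism W (ball 0 1) \<phi> \<psi> \<and> \<phi> p = 0 \<and>
        \<phi> ` (P \<inter> W) = {z \<in> ball 0 1. snd z = 0} \<and>
        \<phi> ` (Q \<inter> W) = {z \<in> ball 0 1. fst z = 0})"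

definition pseudoline_arrangement :: "point set set \<Rightarrow> bool" where
  "pseudoline_arrangement A \<longleftrightarrow> finite A \<and> (\<forall>P\<in>A. pseudoline P) \<and>
     (\<forall>P\<in>A. \<forall>Q\<in>A. P \<noteq> Q \<longrightarrow> (\<exists>p. P \<inter> Q = {p} \<and> is_crossing P Q p))"

definition simple_pseudoline_arrangement :: "point set set \<Rightarrow> bool" where
  "simple_pseudoline_arrangement A \<longleftrightarrow> pseudoline_arrangement A \<and>
     (\<forall>P\<in>A. \<forall>Q\<in>A. \<forall>R\<in>A. \<forall>S\<in>A. P \<noteq> Q \<longrightarrow> R \<noteq> S \<longrightarrow> {P, Q} \<noteq> {R, S} \<longrightarrow>
        P \<inter> Q \<noteq> R \<inter> S)"

definition pa_vertices :: "point set set \<Rightarrow> point set" where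
  "pa_vertices A = {p. \<exists>P\<in>A. \<exists>Q\<in>A. P \<noteq> Q \<and> p \<in> P \<inter> Q}"

definition consecutive_on :: "point set set \<Rightarrow> point set \<Rightarrow> point \<Rightarrow> point \<Rightarrow> bool" where
  "consecutive_on A P u v \<longleftrightarrow>
     (\<exists>h h' s t. homeomorphism UNIV UNIV h h' \<and> P = h ` xaxis \<and> s < t \<and>
        u = h (s, 0) \<and> v = h (t, 0) \<and>
        (\<forall>r. s < r \<and> r < t \<longrightarrow> h (r, 0) \<notin> pa_vertices A))"

definition pa_adj :: "point set set \<Rightarrow> point \<Rightarrow> point \<Rightarrow> bool" where
  "pa_adj A u v \<longleftrightarrow> u \<in> pa_vertices A \<and> v \<in> pa_vertices A \<and> u \<noteq> v \<and>
     (\<exists>P\<in>A. consecutive_on A P u v \<or> consecutive_on A P v u)"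

definition straight_line_drawing ::
  "'v set \<Rightarrow> ('v \<Rightarrow> 'v \<Rightarrow> bool) \<Rightarrow> ('v \<Rightarrow> point) \<Rightarrow> bool" where
  "straight_line_drawing V E d \<longleftrightarrow> inj_on d V \<and>
     (\<forall>u v w. E u v \<and> w \<in> V \<and> w \<noteq> u \<and> w \<noteq> v \<longrightarrow> d w \<notin> closed_segment (d u) (d v)) \<and>
     (\<forall>u v w x. E u v \<and> E w x \<and> {u, v} \<noteq> {w, x} \<longrightarrow>
        closed_segment (d u) (d v) \<inter> closed_segment (d w) (d x) \<subseteq> d ` ({u, v} \<inter> {w, x}))"

(* Wiring diagrams, combinatorially: a wiring diagram with l pseudolines is determined by the
   left-to-right sequence of its crossings; entry i of the list (0-based, i < l - 1) means a
   crossing between tracks i+1 and i+2.  wire_state l w k lists which pseudoline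
   (numbered 0..l-1 by initial track) occupies each track after the first k crossings. *)
definition swap_adj :: "nat \<Rightarrow> nat list \<Rightarrow> nat list" where
  "swap_adj i xs = xs[i := xs ! Suc i, Suc i := xs ! i]"

definition wire_state :: "nat \<Rightarrow> nat list \<Rightarrow> nat \<Rightarrow> nat list" where
  "wire_state l w k = fold swap_adj (take k w) [0..<l]"

definition wiring_diagram :: "nat \<Rightarrow> nat list \<Rightarrow> bool" where
  "wiring_diagram l w \<longleftrightarrow> (\<forall>i\<in>set w. Suc i < l) \<and>
     (\<forall>a<l. \<forall>b<l. a \<noteq> b \<longrightarrow>
        card {k. k < length w \<and>
          {wire_state l w k ! (w ! k), wire_state l w k ! Suc (w ! k)} = {a, b}} = 1)"

definition level_size :: "nat list \<Rightarrow> nat \<Rightarrow> nat" where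
  "level_size w i = card {k. k < length w \<and> w ! k = i}"

definition kappa :: "nat \<Rightarrow> nat list \<Rightarrow> nat" where
  "kappa l w = Max (level_size w ` {..<l - 1})"

definition kappa_max :: "nat \<Rightarrow> nat" where
  "kappa_max l = Max (kappa l ` {w. wiring_diagram l w})"

end

theory Submission
  imports Defs
begin

text \<open>The only topological input is that each pseudoline \<open>Q\<close> passes from one side of every other
  pseudoline \<open>P\<close> to the other side at their crossing. Hence the side of \<open>P\<close> that contains the
  crossing of \<open>Q\<close> and \<open>R\<close> can be read off from the order of the crossings along \<open>Q\<close>, and also from
  the order along \<open>R\<close>. Comparing the two readings for all triples shows that, after reversing some of
  the lines, the lines can be numbered such that for \<open>i < j < k\<close> the three crossings appear either in
  the order \<open>ij, ik, jk\<close> or in the order \<open>jk, ik, ij\<close>. Such orders along the lines extend to a linear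
  order of all crossings, which is a wiring diagram. Two crossings adjacent on a line lie on the same
  level or on neighbouring levels, with no other crossing of these levels in between; so placing each
  level on a horizontal row, in order from left to right, gives a planar straight-line drawing, whatever
  rows are chosen in increasing order. Rows whose capacity is proportional to the largest power of
  \<open>2\<close> dividing the row number accommodate all possible sequences of level sizes.\<close>

section \<open>Wiring diagrams from local sequences\<close>

text \<open>\<open>pos i j\<close> is the coordinate, along line \<open>i\<close>, of its crossing
  with line \<open>j\<close>. The truth value of \<open>pos i j < pos i k\<close> is the orientation
  of the triple \<open>i < j < k\<close>, and \<open>triple\<close> makes all three lines agree on
  it.\<close>

locale local_sequences =
  fixes l :: nat and pos :: "nat \<Rightarrow> nat \<Rightarrow> real"
  assumes pos_neq: "\<lbrakk>i < l; j < l; k < l; j \<noteq> i; k \<noteq> i; j \<noteq> k\<rbrakk> \<Longrightarrow> pos i j \<noteq> pos i k"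
    and triple: "\<lbrakk>i < j; j < k; k < l\<rbrakk> \<Longrightarrow>
      (pos i j < pos i k \<longleftrightarrow> pos j i < pos j k) \<and> (pos i j < pos i k \<longleftrightarrow> pos k i < pos k j)"

definition line_pairs :: "nat \<Rightarrow> nat set set" where
  "line_pairs l = {{a, b} | a b. a < b \<and> b < l}"

definition precedes :: "(nat \<Rightarrow> nat \<Rightarrow> real) \<Rightarrow> nat set \<Rightarrow> nat set \<Rightarrow> bool" where
  "precedes pos e f \<longleftrightarrow> (\<exists>a b c. e = {a, b} \<and> f = {a, c} \<and> pos a b < pos a c)"

lemma in_line_pairs: "{a, b} \<in> line_pairs l \<longleftrightarrow> a \<noteq> b \<and> a < l \<and> b < l"
proof
  assume "{a, b} \<in> line_pairs l"
  then show "a \<noteq> b \<and> a < l \<and> b < l"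
    by (auto simp: line_pairs_def doubleton_eq_iff)
next
  assume ab: "a \<noteq> b \<and> a < l \<and> b < l"
  then show "{a, b} \<in> line_pairs l"
    unfolding line_pairs_def by (cases "a < b") (auto simp: doubleton_eq_iff, metis nat_neq_iff)
qed

lemma line_pairsE:
  assumes "e \<in> line_pairs l"
  obtains a b where "e = {a, b}" "a < b" "b < l"
  using assms by (auto simp: line_pairs_def)

lemma line_pairs_Suc: "line_pairs (Suc n) = line_pairs n \<union> (\<lambda>i. {i, n}) ` {..<n}"
  by (auto simp: line_pairs_def less_Suc_eq image_iff)

text \<open>Each crossing of two of the lines \<open>0, \<dots>, n - 1\<close> lies entirely before or entirely after
  the line \<open>n\<close> on both of its lines, so line \<open>n\<close> can be inserted between these two groups.\<close>
lemma ex_linear_extension: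
  assumes "local_sequences l pos"
  shows "\<exists>es. distinct es \<and> set es = line_pairs l \<and> sorted_wrt (\<lambda>e f. \<not> precedes pos f e) es"
  using assms
proof (induction l)
  case 0
  then show ?case by (intro exI[of _ "[]"]) (auto simp: line_pairs_def)
next
  case (Suc n)
  interpret local_sequences "Suc n" pos by (fact Suc.prems)
  have "local_sequences n pos"
  proof
    show "pos i j \<noteq> pos i k" if "i < n" "j < n" "k < n" "j \<noteq> i" "k \<noteq> i" "j \<noteq> k" for i j k
      using that by (intro pos_neq) auto
  qed (use triple less_SucI in blast)+
  then obtain es where es: "distinct es" "set es = line_pairs n"
    "sorted_wrt (\<lambda>e f. \<not> precedes pos f e) es"
    using Suc.IH by blast
  define early where "early e \<longleftrightarrow> (\<exists>a c. e = {a, c} \<and> pos a c < pos a n)" for e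
  \<comment> \<open>By \<open>triple\<close> with largest index \<open>n\<close>, the comparison
    with \<open>n\<close> has the same outcome along \<open>a\<close> and along
    \<open>c\<close>.\<close>
  have early: "early {a, c} \<longleftrightarrow> pos a c < pos a n" if "a < n" "c < n" "a \<noteq> c" for a c
  proof -
    have "pos a c < pos a n \<longleftrightarrow> pos c a < pos c n"
      using triple[of a c n] triple[of c a n] that by (cases "a < c") auto
    then show ?thesis by (auto simp: early_def doubleton_eq_iff)
  qed
  have late: "pos a n < pos a c" if "a < n" "c < n" "a \<noteq> c" "\<not> early {a, c}" for a c
    using early[of a c] that pos_neq[of a c n] by simp
  define ns where "ns = map (\<lambda>i. {i, n}) (sort_key (pos n) [0..<n])"
  have ns: "set ns = (\<lambda>i. {i, n}) ` {..<n}" "distinct ns"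
    by (auto simp: ns_def distinct_map inj_on_def doubleton_eq_iff)
  have "sorted_wrt (\<lambda>i j. pos n i \<le> pos n j) (sort_key (pos n) [0..<n])"
    by (metis sorted_sort_key sorted_map)
  then have sns: "sorted_wrt (\<lambda>e f. \<not> precedes pos f e) ns"
    unfolding ns_def sorted_wrt_map
    by (rule sorted_wrt_mono_rel[rotated]) (auto simp: precedes_def doubleton_eq_iff)
  define es' where "es' = filter early es @ ns @ filter (\<lambda>e. \<not> early e) es"
  have 1: "\<not> precedes pos f e" if "e \<in> line_pairs n" "early e" "f \<in> set ns" for e f
  proof
    assume "precedes pos f e"
    then obtain a b c where "f = {a, b}" "e = {a, c}" "pos a b < pos a c"
      by (auto simp: precedes_def)
    then show False using that early[of a c]
      by (auto simp: ns in_line_pairs doubleton_eq_iff)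
  qed
  have 2: "\<not> precedes pos f e" if "f \<in> line_pairs n" "\<not> early f" "e \<in> set ns" for e f
  proof
    assume "precedes pos f e"
    then obtain a b c where "f = {a, b}" "e = {a, c}" "pos a b < pos a c"
      by (auto simp: precedes_def)
    then show False using that late[of a b]
      by (auto simp: ns in_line_pairs doubleton_eq_iff)
  qed
  \<comment> \<open>On a common line \<open>a\<close>, the crossing with \<open>n\<close> separates
    the two: \<open>e\<close> comes before it and \<open>f\<close> after it.\<close>
  have 3: "\<not> precedes pos f e"
    if "e \<in> line_pairs n" "early e" "f \<in> line_pairs n" "\<not> early f" for e f
  proof
    assume "precedes pos f e"
    then obtain a b c where "f = {a, b}" "e = {a, c}" "pos a b < pos a c"
      by (auto simp: precedes_def)
    then show False using that late[of a b] early[of a c]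
      by (auto simp: in_line_pairs)
  qed
  have "sorted_wrt (\<lambda>e f. \<not> precedes pos f e) es'"
    unfolding es'_def sorted_wrt_append using es sns 1 2 3
    by (auto intro!: sorted_wrt_filter)
  moreover have "distinct es'"
    using es ns by (auto simp: es'_def in_line_pairs)
  moreover have "set es' = line_pairs (Suc n)"
    using es ns by (auto simp: es'_def line_pairs_Suc)
  ultimately show ?case by blast
qed

section \<open>Wire states and finiteness of the set of wiring diagrams\<close>

lemma length_swap_adj [simp]: "length (swap_adj i xs) = length xs"
  by (simp add: swap_adj_def)

lemma wire_state_Suc:
  assumes "k < length w"
  shows "wire_state l w (Suc k) = swap_adj (w ! k) (wire_state l w k)"
  using assms by (simp add: wire_state_def take_Suc_conv_app_nth)

lemma mset_wire_state:
  assumes "\<forall>i\<in>set w. Suc i < l" "k \<le> length w"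
  shows "mset (wire_state l w k) = mset [0..<l]"
  using assms(2)
proof (induction k)
  case 0
  then show ?case by (simp add: wire_state_def)
next
  case (Suc k)
  have "length (wire_state l w k) = l"
    using Suc by (metis Suc_leD size_mset length_upt diff_zero)
  moreover have "Suc (w ! k) < l" using assms(1) Suc.prems by auto
  ultimately show ?case
    using Suc mset_swap[of "Suc (w ! k)" "wire_state l w k" "w ! k"]
    by (simp add: wire_state_Suc swap_adj_def)
qed

text \<open>Every entry swaps two distinct lines and no pair is swapped twice, so the entries inject
  into the subsets of \<open>{..<l}\<close>, which bounds the length. Finiteness is what makes the
  \<open>Max\<close> in \<open>kappa_max\<close> an upper bound.\<close>

lemma wiring_diagram_finite: "finite {w. wiring_diagram l w}"
proof -
  have "length w \<le> card (Pow {..<l})" if w: "wiring_diagram l w" for w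
  proof -
    define e where "e k = {wire_state l w k ! (w ! k), wire_state l w k ! Suc (w ! k)}" for k
    have *: "\<exists>a b. a < l \<and> b < l \<and> a \<noteq> b \<and> e k = {a, b}" if k: "k < length w" for k
    proof -
      have m: "mset (wire_state l w k) = mset [0..<l]"
        using mset_wire_state[of w l k] w k by (auto simp: wiring_diagram_def)
      have len: "length (wire_state l w k) = l"
        using m by (metis size_mset length_upt diff_zero)
      have set: "set (wire_state l w k) = {..<l}"
        using m by (metis set_mset_mset set_upt atLeast0LessThan)
      have d: "distinct (wire_state l w k)"
        using m by (metis mset_eq_imp_distinct_iff distinct_upt)
      have s: "Suc (w ! k) < l" using w k by (auto simp: wiring_diagram_def)
      show ?thesis
        unfolding e_def
        using s len set d nth_mem[of "w ! k" "wire_state l w k"]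
          nth_mem[of "Suc (w ! k)" "wire_state l w k"]
        by (intro exI conjI) (auto simp: nth_eq_iff_index_eq)
    qed
    have "inj_on e {..<length w}"
    proof (rule inj_onI)
      fix j k assume jk: "j \<in> {..<length w}" "k \<in> {..<length w}" "e j = e k"
      obtain a b where ab: "a < l" "b < l" "a \<noteq> b" "e k = {a, b}" using * jk by blast
      have "card {k. k < length w \<and> e k = {a, b}} = 1"
        using w ab by (simp add: wiring_diagram_def e_def)
      then obtain m where "{k. k < length w \<and> e k = {a, b}} = {m}" by (auto simp: card_1_singleton_iff)
      then have "j \<in> {m}" "k \<in> {m}" using jk ab by blast+
      then show "j = k" by simp
    qed
    moreover have "e ` {..<length w} \<subseteq> Pow {..<l}"
      using * by fastforce
    ultimately show ?thesis
      by (metis card_inj_on_le card_lessThan finite_Pow_iff finite_lessThan)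
  qed
  then have "{w. wiring_diagram l w} \<subseteq> {w. set w \<subseteq> {..<l} \<and> length w \<le> card (Pow {..<l})}"
    by (auto simp: wiring_diagram_def)
  then show ?thesis
    using finite_lists_length_le[of "{..<l}"] finite_subset by blast
qed

lemma level_size_le_kappa_max:
  assumes "wiring_diagram l w" "i < l - 1"
  shows "level_size w i \<le> kappa_max l"
proof -
  have "level_size w i \<le> kappa l w"
    unfolding kappa_def using assms by (intro Max_ge) auto
  also have "\<dots> \<le> kappa_max l"
    unfolding kappa_max_def using assms wiring_diagram_finite by (intro Max_ge) auto
  finally show ?thesis .
qed

lemma sum_level_size:
  assumes "wiring_diagram l w"
  shows "(\<Sum>i<l - 1. level_size w i) = length w"
proof -
  have "(\<Sum>i<l - 1. level_size w i) = (\<Sum>i\<in>{..<l - 1}. \<Sum>k\<in>{k\<in>{..<length w}. w ! k = i}. 1)"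
    by (simp add: level_size_def)
  also have "\<dots> = (\<Sum>k<length w. 1)"
    by (rule sum.group) (use assms in \<open>auto simp: wiring_diagram_def less_diff_conv\<close>)
  finally show ?thesis by simp
qed

section \<open>The wiring diagram read off from a linear order of the crossings\<close>

locale crossing_sequence = local_sequences +
  fixes es :: "nat set list"
  assumes distinct_es: "distinct es"
    and set_es: "set es = line_pairs l"
    and sorted_es: "sorted_wrt (\<lambda>e f. \<not> precedes pos f e) es"
begin

text \<open>Two lines have exchanged their initial order if and only if their crossing is among the
  first \<open>k\<close> ones.\<close>
definition before :: "nat \<Rightarrow> nat \<Rightarrow> nat \<Rightarrow> bool" where
  "before k c a \<longleftrightarrow> (c < a) \<noteq> ({c, a} \<in> set (take k es))"

definition track :: "nat \<Rightarrow> nat \<Rightarrow> nat" where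
  "track k a = card {c. c < l \<and> c \<noteq> a \<and> before k c a}"

text \<open>\<open>Min (es ! k)\<close> is the lower of the two lines just before they cross,
  because they are still in their initial order. Its track, counted from \<open>0\<close>, is the
  level of the crossing.\<close>

definition diagram :: "nat list" where
  "diagram = map (\<lambda>k. track k (Min (es ! k))) [0..<length es]"

lemma length_diagram [simp]: "length diagram = length es"
  by (simp add: diagram_def)

lemma es_nth_eq:
  assumes "k < length es"
  obtains a b where "es ! k = {a, b}" "a < b" "b < l"
  using assms set_es nth_mem line_pairsE by metis

lemma pos_less_iff:
  assumes "j < length es" "k < length es" "es ! j = {a, c}" "es ! k = {a, b}"
  shows "pos a c < pos a b \<longleftrightarrow> j < k"
proof (cases j k rule: linorder_cases)
  case less
  then have "\<not> precedes pos (es ! k) (es ! j)"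
    using sorted_es assms(2) by (simp add: sorted_wrt_iff_nth_less)
  then have "\<not> pos a b < pos a c" using assms by (auto simp: precedes_def)
  moreover have "b \<noteq> c"
    using less assms distinct_es by (metis less_irrefl nth_eq_iff_index_eq)
  moreover have "{a, c} \<in> line_pairs l" "{a, b} \<in> line_pairs l"
    using assms set_es nth_mem by metis+
  ultimately have "pos a c < pos a b" using pos_neq[of a b c] by (simp add: in_line_pairs)
  then show ?thesis using less by simp
next
  case equal
  then show ?thesis using assms by (auto simp: doubleton_eq_iff)
next
  case greater
  then have "\<not> precedes pos (es ! j) (es ! k)"
    using sorted_es assms(1) by (simp add: sorted_wrt_iff_nth_less)
  then show ?thesis using assms greater by (auto simp: precedes_def)
qed

lemma in_take_iff:
  assumes "k < length es" "es ! k = {a, b}" "c < l" "c \<noteq> a"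
  shows "{a, c} \<in> set (take k es) \<longleftrightarrow> pos a c < pos a b"
proof -
  have "{a, b} \<in> line_pairs l" using assms set_es nth_mem by metis
  then have "{a, c} \<in> set es" using assms by (auto simp: set_es in_line_pairs)
  then obtain j where j: "j < length es" "es ! j = {a, c}" by (auto simp: in_set_conv_nth)
  have "{a, c} \<in> set (take k es) \<longleftrightarrow> (\<exists>i<k. es ! i = es ! j)"
    using assms(1) j by (auto simp: in_set_conv_nth)
  also have "\<dots> \<longleftrightarrow> j < k"
    using j distinct_es assms(1) by (metis nth_eq_iff_index_eq order.strict_trans)
  finally have "{a, c} \<in> set (take k es) \<longleftrightarrow> j < k" .
  then show ?thesis using pos_less_iff[of j k a c b] j assms by simp
qed

text \<open>When \<open>a\<close> and \<open>b\<close> are about to cross, no third line separates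
  them. By \<open>triple\<close>, \<open>c\<close> has crossed both or neither of them if it is
  numbered outside the interval from \<open>a\<close> to \<open>b\<close>, and exactly one of them
  if \<open>a < c < b\<close>.\<close>

lemma before_same:
  assumes k: "k < length es" "es ! k = {a, b}" "a < b" and c: "c < l" "c \<noteq> a" "c \<noteq> b"
  shows "before k c a \<longleftrightarrow> before k c b"
proof -
  have "{a, b} \<in> line_pairs l" using assms set_es nth_mem by metis
  then have l: "a < l" "b < l" by (auto simp: in_line_pairs)
  have 1: "{c, a} \<in> set (take k es) \<longleftrightarrow> pos a c < pos a b"
    "{c, b} \<in> set (take k es) \<longleftrightarrow> pos b c < pos b a"
    using in_take_iff[of k a b c] in_take_iff[of k b a c] assms by (auto simp: insert_commute)
  have "pos a c \<noteq> pos a b" "pos b c \<noteq> pos b a" using pos_neq l c k by auto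
  then show ?thesis
    unfolding before_def 1
    using triple[of c a b] triple[of a c b] triple[of a b c] l c k by (smt (verit) nat_neq_iff)
qed

lemma set_take_Suc: "k < length es \<Longrightarrow> set (take (Suc k) es) = insert (es ! k) (set (take k es))"
  by (simp add: take_Suc_conv_app_nth)

lemma nth_notin_take: "k < length es \<Longrightarrow> es ! k \<notin> set (take k es)"
  using distinct_es by (auto simp: in_set_conv_nth nth_eq_iff_index_eq)

lemma before_Suc:
  assumes "k < length es"
  shows "before (Suc k) c a \<longleftrightarrow> (if es ! k = {c, a} then \<not> before k c a else before k c a)"
  using assms nth_notin_take[OF assms] by (auto simp: before_def set_take_Suc)

lemma track_Suc_other: "\<lbrakk>k < length es; a \<notin> es ! k\<rbrakk> \<Longrightarrow> track (Suc k) a = track k a"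
  unfolding track_def by (rule arg_cong[where f = card]) (auto simp: before_Suc)

text \<open>By \<open>before_same\<close> the same set \<open>S\<close> of other lines lies below
  \<open>a\<close> and below \<open>b\<close>. Only the comparison of \<open>a\<close> with
  \<open>b\<close> changes, so the tracks \<open>card S\<close> and \<open>Suc (card S)\<close> are
  exchanged.\<close>

lemma track_crossing:
  assumes k: "k < length es" "es ! k = {a, b}" "a < b"
  shows "track k b = Suc (track k a)" "track (Suc k) a = Suc (track k a)"
    "track (Suc k) b = track k a"
proof -
  have "{a, b} \<in> line_pairs l" using assms set_es nth_mem by metis
  then have l: "a < l" "b < l" by (auto simp: in_line_pairs)
  define S where "S = {c. c < l \<and> c \<noteq> a \<and> c \<noteq> b \<and> before k c a}"
  have S: "finite S" "a \<notin> S" "b \<notin> S" by (auto simp: S_def)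
  have "{a, b} \<notin> set (take k es)" using nth_notin_take[of k] k by simp
  then have ab: "before k a b" "\<not> before k b a" using k by (auto simp: before_def insert_commute)
  have "{c. c < l \<and> c \<noteq> a \<and> before k c a} = S" using ab by (auto simp: S_def)
  then have t: "track k a = card S" by (simp add: track_def)
  have "{c. c < l \<and> c \<noteq> b \<and> before k c b} = insert a S"
    using ab l k before_same[of k a b] by (auto simp: S_def)
  then show "track k b = Suc (track k a)" using S t by (simp add: track_def)
  have "{c. c < l \<and> c \<noteq> a \<and> before (Suc k) c a} = insert b S"
    using ab l k by (auto simp: S_def before_Suc doubleton_eq_iff)
  then show "track (Suc k) a = Suc (track k a)" using S t by (simp add: track_def)
  have "{c. c < l \<and> c \<noteq> b \<and> before (Suc k) c b} = S"
    using ab l k before_same[of k a b] by (auto simp: S_def before_Suc doubleton_eq_iff)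
  then show "track (Suc k) b = track k a" using t by (simp add: track_def)
qed

lemma diagram_nth: "\<lbrakk>k < length es; es ! k = {a, b}; a < b\<rbrakk> \<Longrightarrow> diagram ! k = track k a"
  by (simp add: diagram_def)

lemma track_less:
  assumes "a < l"
  shows "track k a < l"
proof -
  have "track k a \<le> card ({..<l} - {a})" unfolding track_def by (rule card_mono) auto
  then show ?thesis using assms by simp
qed

lemma Suc_diagram_less: "k < length es \<Longrightarrow> Suc (diagram ! k) < l"
  by (metis diagram_nth es_nth_eq track_crossing(1) track_less)

text \<open>Ties the counting definition of \<open>track\<close> to the actual swaps. A line not
  involved in a swap keeps its track, which differs from the swapped ones because the state has
  other entries there.\<close>

lemma wire_state_track:
  assumes "k \<le> length es"
  shows "length (wire_state l diagram k) = l \<and> (\<forall>a<l. wire_state l diagram k ! track k a = a)"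
  using assms
proof (induction k)
  case 0
  have "track 0 a = a" if "a < l" for a
  proof -
    have "{c. c < l \<and> c \<noteq> a \<and> before 0 c a} = {..<a}" using that by (auto simp: before_def)
    then show ?thesis by (simp add: track_def)
  qed
  then show ?case by (simp add: wire_state_def)
next
  case (Suc k)
  define s where "s = wire_state l diagram k"
  have k: "k < length es" using Suc.prems by simp
  have s: "length s = l" "\<And>a. a < l \<Longrightarrow> s ! track k a = a" using Suc by (auto simp: s_def)
  obtain a b where ab: "es ! k = {a, b}" "a < b" "b < l" using es_nth_eq[OF k] .
  note t = track_crossing[OF k ab(1,2)]
  have d: "diagram ! k = track k a" using diagram_nth[OF k ab(1,2)] .
  have less: "Suc (track k a) < l" using t(1) track_less[OF ab(3), of k] by simp
  have sab: "s ! track k a = a" "s ! Suc (track k a) = b" using s ab t by (auto simp flip: t(1))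
  have "swap_adj (track k a) s ! track (Suc k) c = c" if c: "c < l" for c
  proof (cases "c = a \<or> c = b")
    case True
    then show ?thesis using t sab less s ab by (auto simp: swap_adj_def)
  next
    case False
    then have "track (Suc k) c = track k c" using track_Suc_other[OF k] ab by auto
    moreover have "track k c \<noteq> track k a" "track k c \<noteq> Suc (track k a)"
      using s(2)[OF c] sab False by auto
    ultimately show ?thesis using s c by (auto simp: swap_adj_def)
  qed
  then show ?case using k s d by (simp add: wire_state_Suc flip: s_def)
qed

lemma diagram_crossing:
  assumes k: "k < length es"
  shows "{wire_state l diagram k ! (diagram ! k), wire_state l diagram k ! Suc (diagram ! k)} = es ! k"
proof -
  obtain a b where ab: "es ! k = {a, b}" "a < b" "b < l" using es_nth_eq[OF k] .
  then show ?thesis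
    using wire_state_track[of k] k track_crossing(1)[OF k ab(1,2)] diagram_nth[OF k ab(1,2)]
    by (metis less_imp_le order.strict_trans)
qed

lemma wiring_diagram_diagram: "wiring_diagram l diagram"
proof -
  have "card {k. k < length es \<and> es ! k = {a, b}} = 1" if ab: "a < l" "b < l" "a \<noteq> b" for a b
  proof -
    have "{a, b} \<in> set es" using ab by (simp add: set_es in_line_pairs)
    then obtain k where "k < length es" "es ! k = {a, b}" by (auto simp: in_set_conv_nth)
    then have "{k. k < length es \<and> es ! k = {a, b}} = {k}"
      using distinct_es by (auto simp flip: nth_eq_iff_index_eq)
    then show ?thesis by simp
  qed
  moreover have "{k. k < length es \<and> {wire_state l diagram k ! (diagram ! k),
      wire_state l diagram k ! Suc (diagram ! k)} = {a, b}} = {k. k < length es \<and> es ! k = {a, b}}" for a b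
    using diagram_crossing by auto
  ultimately show ?thesis
    using Suc_diagram_less by (auto simp: wiring_diagram_def in_set_conv_nth)
qed

lemma track_const:
  assumes "m \<le> k'" "k' \<le> length es" "\<And>j. \<lbrakk>m \<le> j; j < k'\<rbrakk> \<Longrightarrow> a \<notin> es ! j"
  shows "track k' a = track m a"
  using assms by (induction rule: dec_induct) (auto simp: track_Suc_other)

end

text \<open>Levels are counted from \<open>0\<close>, so the levels touching track \<open>q\<close> are \<open>q - 1\<close> and \<open>q\<close>
  (only \<open>0\<close> for \<open>q = 0\<close>, where the truncated subtraction is harmless).\<close>
definition wire_consecutive :: "nat list \<Rightarrow> nat \<Rightarrow> nat \<Rightarrow> bool" where
  "wire_consecutive w j k \<longleftrightarrow> j < k \<and> k < length w \<and>
     (\<exists>q. w ! j \<in> {q, q - 1} \<and> w ! k \<in> {q, q - 1} \<and>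
        (\<forall>m. j < m \<and> m < k \<longrightarrow> w ! m \<notin> {q, q - 1}))"

text \<open>Between the two crossings line \<open>a\<close> stays on one track \<open>q\<close>, so
  both lie on levels touching \<open>q\<close>. A crossing on such a level in between would involve
  the line on track \<open>q\<close>, which is \<open>a\<close>.\<close>

lemma (in crossing_sequence) wire_consecutive_diagram:
  assumes jk: "j < k" "k < length es" and a: "a \<in> es ! j" "a \<in> es ! k"
    and between: "\<And>m. \<lbrakk>j < m; m < k\<rbrakk> \<Longrightarrow> a \<notin> es ! m"
  shows "wire_consecutive diagram j k"
proof -
  define q where "q = track (Suc j) a"
  have q: "track m a = q" if "j < m" "m \<le> k" for m
    unfolding q_def using that jk between by (intro track_const) auto
  have "a < l" using a jk es_nth_eq[of k] by (metis insert_iff singletonD order.strict_trans)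
  have j: "diagram ! j \<in> {q, q - 1}"
  proof -
    obtain x y where xy: "es ! j = {x, y}" "x < y" "y < l" using es_nth_eq[of j] jk by auto
    have "j < length es" using jk by simp
    note t = track_crossing[OF this xy(1,2)] diagram_nth[OF this xy(1,2)]
    show ?thesis using a(1) xy t by (auto simp: q_def)
  qed
  have k: "diagram ! k \<in> {q, q - 1}"
  proof -
    obtain x y where xy: "es ! k = {x, y}" "x < y" "y < l" using es_nth_eq[of k] jk by auto
    note t = track_crossing[OF jk(2) xy(1,2)] diagram_nth[OF jk(2) xy(1,2)]
    show ?thesis using a(2) xy t q[of k] jk by auto
  qed
  have "diagram ! m \<notin> {q, q - 1}" if m: "j < m" "m < k" for m
  proof
    assume *: "diagram ! m \<in> {q, q - 1}"
    have "q = diagram ! m \<or> q = Suc (diagram ! m)" using * by auto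
    then have "wire_state l diagram m ! q \<in> es ! m"
      using diagram_crossing[of m] m jk by auto
    then show False
      using wire_state_track[of m] q[of m] between[OF m] m jk \<open>a < l\<close> by auto
  qed
  then show ?thesis unfolding wire_consecutive_def using jk j k by auto
qed

section \<open>Drawing a wiring diagram by levels\<close>

lemma straight_line_drawing_comp:
  assumes "straight_line_drawing V' E' d" "inj_on f V" "f ` V \<subseteq> V'"
    and E: "\<And>u v. E u v \<Longrightarrow> u \<in> V \<and> v \<in> V \<and> E' (f u) (f v)"
  shows "straight_line_drawing V E (d \<circ> f)"
proof -
  have inj: "inj_on d V'"
    and vert: "\<And>u v w. \<lbrakk>E' u v; w \<in> V'; w \<noteq> u; w \<noteq> v\<rbrakk> \<Longrightarrow> d w \<notin> closed_segment (d u) (d v)"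
    and edge: "\<And>u v w x. \<lbrakk>E' u v; E' w x; {u, v} \<noteq> {w, x}\<rbrakk> \<Longrightarrow>
        closed_segment (d u) (d v) \<inter> closed_segment (d w) (d x) \<subseteq> d ` ({u, v} \<inter> {w, x})"
    using assms(1) by (auto simp: straight_line_drawing_def)
  have eq: "f u = f v \<longleftrightarrow> u = v" if "u \<in> V" "v \<in> V" for u v
    using assms(2) that by (simp add: inj_on_eq_iff)
  show ?thesis
    unfolding straight_line_drawing_def
  proof (intro conjI allI impI)
    show "inj_on (d \<circ> f) V"
      using assms(2,3) inj by (metis comp_inj_on inj_on_subset)
  next
    fix u v w assume "E u v \<and> w \<in> V \<and> w \<noteq> u \<and> w \<noteq> v"
    then show "(d \<circ> f) w \<notin> closed_segment ((d \<circ> f) u) ((d \<circ> f) v)"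
      using vert[of "f u" "f v" "f w"] E[of u v] eq assms(3) by auto
  next
    fix u v w x assume *: "E u v \<and> E w x \<and> {u, v} \<noteq> {w, x}"
    then have V: "u \<in> V" "v \<in> V" "w \<in> V" "x \<in> V" "E' (f u) (f v)" "E' (f w) (f x)"
      using E by blast+
    have "f ` {u, v} \<noteq> f ` {w, x}"
      using * V inj_on_image_eq_iff[OF assms(2), of "{u, v}" "{w, x}"] by simp
    then have "closed_segment (d (f u)) (d (f v)) \<inter> closed_segment (d (f w)) (d (f x))
        \<subseteq> d ` ({f u, f v} \<inter> {f w, f x})"
      using edge V by simp
    also have "{f u, f v} \<inter> {f w, f x} = f ` ({u, v} \<inter> {w, x})"
      using V inj_on_image_Int[OF assms(2), of "{u, v}" "{w, x}"] by simp
    finally show "closed_segment ((d \<circ> f) u) ((d \<circ> f) v) \<inter> closed_segment ((d \<circ> f) w) ((d \<circ> f) x)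
        \<subseteq> (d \<circ> f) ` ({u, v} \<inter> {w, x})"
      by (simp add: image_comp)
  qed
qed

lemma closed_segment_prodE:
  fixes a b z :: point
  assumes "z \<in> closed_segment a b"
  obtains t where "0 \<le> t" "t \<le> 1" "fst z = (1 - t) * fst a + t * fst b"
    "snd z = (1 - t) * snd a + t * snd b"
  using assms by (auto simp: closed_segment_def)

lemma convex_combination_strict:
  fixes a b t :: real
  assumes "a < b" "0 < t" "t < 1"
  shows "a < (1 - t) * a + t * b" "(1 - t) * a + t * b < b"
proof -
  have "0 < t * (b - a)" "0 < (1 - t) * (b - a)" using assms by simp_all
  then show "a < (1 - t) * a + t * b" "(1 - t) * a + t * b < b" by (simp_all add: algebra_simps)
qed

text \<open>Abscissas are compared within one level only, and rows merely increase with the level.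
  This freedom lets every row be filled from the left and lets rows be skipped.\<close>

locale level_drawing =
  fixes w :: "nat list" and x :: "nat \<Rightarrow> real" and y :: "nat \<Rightarrow> real"
  assumes x_less: "\<lbrakk>j < k; k < length w; w ! j = w ! k\<rbrakk> \<Longrightarrow> x j < x k"
    and y_less: "\<lbrakk>a \<in> set w; b \<in> set w; a < b\<rbrakk> \<Longrightarrow> y a < y b"
begin

definition place :: "nat \<Rightarrow> point" where
  "place k = (x k, y (w ! k))"

definition edge :: "nat \<Rightarrow> nat \<Rightarrow> bool" where
  "edge j k \<longleftrightarrow> wire_consecutive w j k \<or> wire_consecutive w k j"

definition upward :: "nat \<Rightarrow> nat \<Rightarrow> bool" where
  "upward j k \<longleftrightarrow> edge j k \<and> (w ! k = Suc (w ! j) \<or> w ! j = w ! k \<and> j < k)"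

text \<open>An \<open>edge\<close> does not record which end comes first, hence the disjunctions in
  the last two clauses. Their content is that the levels of the ends have no crossing strictly
  between \<open>j\<close> and \<open>k\<close>.\<close>

lemma edgeD:
  assumes "edge j k"
  shows "j < length w" "k < length w" "j \<noteq> k"
    "\<lbrakk>w ! m = w ! j \<or> w ! m = w ! k; j < m\<rbrakk> \<Longrightarrow> k \<le> m \<or> k < j"
    "\<lbrakk>w ! m = w ! j \<or> w ! m = w ! k; k < m\<rbrakk> \<Longrightarrow> j \<le> m \<or> j < k"
proof -
  have wc: "\<lbrakk>wire_consecutive w j k; w ! m = w ! j \<or> w ! m = w ! k; j < m\<rbrakk> \<Longrightarrow> k \<le> m" for j k m
    by (metis wire_consecutive_def not_le)
  show "j < length w" "k < length w" "j \<noteq> k"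
    using assms by (auto simp: edge_def wire_consecutive_def)
  show "\<lbrakk>w ! m = w ! j \<or> w ! m = w ! k; j < m\<rbrakk> \<Longrightarrow> k \<le> m \<or> k < j"
    "\<lbrakk>w ! m = w ! j \<or> w ! m = w ! k; k < m\<rbrakk> \<Longrightarrow> j \<le> m \<or> j < k"
    using assms wc[of j k m] wc[of k j m] by (auto simp: edge_def wire_consecutive_def)
qed

lemma upward_cases:
  assumes "edge j k"
  shows "upward j k \<or> upward k j"
proof -
  have "w ! k = Suc (w ! j) \<or> w ! j = Suc (w ! k) \<or> w ! j = w ! k"
    using assms by (auto simp: edge_def wire_consecutive_def)
  moreover have "edge k j" using assms by (auto simp: edge_def)
  ultimately show ?thesis
    using assms edgeD(3)[OF assms] by (auto simp: upward_def)
qed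

lemma x_less_iff: "\<lbrakk>j < length w; k < length w; w ! j = w ! k\<rbrakk> \<Longrightarrow> x j < x k \<longleftrightarrow> j < k"
  using x_less[of j k] x_less[of k j] by (cases j k rule: linorder_cases) auto

lemma y_less_iff: "\<lbrakk>j < length w; k < length w\<rbrakk> \<Longrightarrow> y (w ! j) < y (w ! k) \<longleftrightarrow> w ! j < w ! k"
  using y_less[of "w ! j" "w ! k"] y_less[of "w ! k" "w ! j"]
  by (cases "w ! j" "w ! k" rule: linorder_cases) auto

lemma y_eq_iff: "\<lbrakk>j < length w; k < length w\<rbrakk> \<Longrightarrow> y (w ! j) = y (w ! k) \<longleftrightarrow> w ! j = w ! k"
  using y_less_iff[of j k] y_less_iff[of k j] by (cases "w ! j" "w ! k" rule: linorder_cases) auto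

lemma inj_place: "inj_on place {..<length w}"
  by (rule inj_onI) (auto simp: place_def y_eq_iff, metis less_irrefl nat_neq_iff x_less)

text \<open>A vertex inside an edge along a row would be a crossing of that level between two
  consecutive ones. An edge joining neighbouring levels meets no occupied row in its
  interior.\<close>

lemma place_notin_edge:
  assumes e: "upward j k" and m: "m < length w" "m \<noteq> j" "m \<noteq> k"
  shows "place m \<notin> closed_segment (place j) (place k)"
proof
  assume "place m \<in> closed_segment (place j) (place k)"
  then obtain t where t: "0 \<le> t" "t \<le> 1" "x m = (1 - t) * x j + t * x k"
    "y (w ! m) = (1 - t) * y (w ! j) + t * y (w ! k)"
    by (auto elim!: closed_segment_prodE simp: place_def)
  have jk: "j < length w" "k < length w" using e edgeD by (auto simp: upward_def)
  have "place m \<noteq> place j" "place m \<noteq> place k"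
    using inj_place m jk by (auto simp: inj_on_def)
  then have "t \<noteq> 0" "t \<noteq> 1" using t by (auto simp: place_def)
  then have t01: "0 < t" "t < 1" using t by auto
  show False
  proof (cases "w ! j = w ! k")
    case True
    then have "j < k" using e by (auto simp: upward_def)
    then have "x j < x k" using x_less jk True by simp
    then have "x j < x m" "x m < x k" using convex_combination_strict t01 t by metis+
    moreover have "w ! m = w ! j" using t True jk m y_eq_iff[of m j] by (simp add: algebra_simps)
    ultimately have "j < m" "m < k" using x_less_iff jk m True by auto
    then show False
      using edgeD(4)[of j k m] e \<open>w ! m = w ! j\<close> by (auto simp: upward_def)
  next
    case False
    then have "w ! k = Suc (w ! j)" using e by (auto simp: upward_def)
    then have "y (w ! j) < y (w ! k)" using jk y_less_iff by (metis lessI)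
    then have "y (w ! j) < y (w ! m)" "y (w ! m) < y (w ! k)"
      using convex_combination_strict t01 t by metis+
    then have "w ! j < w ! m" "w ! m < w ! k" using jk m y_less_iff by auto
    then show False using \<open>w ! k = Suc (w ! j)\<close> by simp
  qed
qed

lemma edge_within_level:
  assumes "upward j k" "w ! j = w ! k" "z \<in> closed_segment (place j) (place k)"
  shows "snd z = y (w ! j)"
  using assms by (auto elim!: closed_segment_prodE simp: place_def algebra_simps)

lemma edge_between_levels:
  assumes "upward j k" "w ! k = Suc (w ! j)" "z \<in> closed_segment (place j) (place k)"
    "z \<noteq> place j" "z \<noteq> place k"
  obtains t where "0 < t" "t < 1" "fst z = (1 - t) * x j + t * x k"
    "snd z = (1 - t) * y (w ! j) + t * y (w ! k)" "y (w ! j) < snd z" "snd z < y (w ! k)"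
proof -
  obtain t where t: "0 \<le> t" "t \<le> 1" "fst z = (1 - t) * x j + t * x k"
    "snd z = (1 - t) * y (w ! j) + t * y (w ! k)"
    using assms(3) by (auto elim!: closed_segment_prodE simp: place_def)
  have "t \<noteq> 0" "t \<noteq> 1" using t assms by (auto simp: place_def prod_eq_iff)
  then have t01: "0 < t" "t < 1" using t by auto
  have "y (w ! j) < y (w ! k)"
    using assms(1,2) y_less_iff edgeD(1,2) unfolding upward_def by (metis lessI)
  then show ?thesis using that t01 t convex_combination_strict by metis
qed

text \<open>Suppose \<open>k' < k\<close>. Since \<open>j'\<close> comes after \<open>j\<close> and
  not strictly between \<open>j\<close> and \<open>k\<close>, it comes after \<open>k\<close>; since
  \<open>k\<close> comes after \<open>k'\<close> and not strictly between \<open>k'\<close> and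
  \<open>j'\<close>, it comes after \<open>j'\<close>.\<close>

lemma between_levels_ordered:
  assumes e: "upward j k" "w ! k = Suc (w ! j)" "upward j' k'" "w ! k' = Suc (w ! j')"
    and "w ! j = w ! j'" "j < j'"
  shows "k \<le> k'"
proof (rule ccontr)
  assume less: "\<not> k \<le> k'"
  have E: "edge j k" "edge j' k'" using e by (auto simp: upward_def)
  have ne: "j' \<noteq> k" using assms by auto
  have "k \<le> j' \<or> k < j" using edgeD(4)[OF E(1), of j'] assms by simp
  moreover have "j' \<le> k \<or> j' < k'" using edgeD(5)[OF E(2), of k] assms less by simp
  ultimately show False using ne less \<open>j < j'\<close> by linarith
qed

lemma edge_strictly_between_levels:
  assumes "upward j k" "w ! k = Suc (w ! j)" "z \<in> closed_segment (place j) (place k)"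
    "z \<noteq> place j" "z \<noteq> place k"
  shows "y (w ! j) < snd z" "snd z < y (w ! k)"
  using edge_between_levels[OF assms] by blast+

text \<open>Edges in one row are intervals between consecutive crossings. The interior of an edge
  between neighbouring levels avoids the occupied rows, and two such edges can meet only in the same
  strip, where their ends are ordered alike on both rows.\<close>

lemma edges_disjoint:
  assumes e: "upward j k" "upward j' k'" "(j, k) \<noteq> (j', k')"
    and z: "z \<in> closed_segment (place j) (place k)" "z \<in> closed_segment (place j') (place k')"
    and nz: "z \<noteq> place j" "z \<noteq> place k" "z \<noteq> place j'" "z \<noteq> place k'"
  shows False
proof -
  have l: "j < length w" "k < length w" "j' < length w" "k' < length w"
    using e edgeD by (auto simp: upward_def)
  consider "w ! j = w ! k" "w ! j' = w ! k'" | "w ! j = w ! k" "w ! k' = Suc (w ! j')"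
    | "w ! k = Suc (w ! j)" "w ! j' = w ! k'" | "w ! k = Suc (w ! j)" "w ! k' = Suc (w ! j')"
    using e by (auto simp: upward_def)
  then show False
  proof cases
    case 1
    then have "y (w ! j) = y (w ! j')" using edge_within_level e z by metis
    then have eq: "w ! j = w ! j'" using y_eq_iff l by simp
    have lt: "j < k" "j' < k'" using 1 e by (auto simp: upward_def)
    obtain s where s: "0 \<le> s" "s \<le> 1" "fst z = (1 - s) * x j + s * x k"
      using z(1) by (auto elim!: closed_segment_prodE simp: place_def)
    obtain t where t: "0 \<le> t" "t \<le> 1" "fst z = (1 - t) * x j' + t * x k'"
      using z(2) by (auto elim!: closed_segment_prodE simp: place_def)
    have sz: "snd z = y (w ! j)" using edge_within_level e z 1 by metis
    have "s \<noteq> 0" "s \<noteq> 1" "t \<noteq> 0" "t \<noteq> 1"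
      using s t sz nz eq 1 by (auto simp: place_def prod_eq_iff)
    then have "x j < fst z" "fst z < x k" "x j' < fst z" "fst z < x k'"
      using convex_combination_strict[of "x j" "x k" s] convex_combination_strict[of "x j'" "x k'" t]
        x_less l lt 1 s t by auto
    \<comment> \<open>The open intervals overlap, so each starts before the other ends; as neither
      contains a crossing of the level, they coincide.\<close>
    then have "x j < x k'" "x j' < x k" by auto
    then have "j < k'" "j' < k" using x_less_iff l eq 1 by auto
    moreover have E: "edge j k" "edge j' k'" using e by (auto simp: upward_def)
    moreover have "j < j' \<Longrightarrow> k \<le> j'" "j' < j \<Longrightarrow> k' \<le> j" "j' < k \<Longrightarrow> k' \<le> k" "j < k' \<Longrightarrow> k \<le> k'"
      using edgeD(4)[OF E(1), of j'] edgeD(4)[OF E(2), of j] edgeD(4)[OF E(2), of k]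
        edgeD(4)[OF E(1), of k'] eq 1 lt by auto
    ultimately have "j = j'" "k = k'" by linarith+
    then show False using e(3) by simp
  next
    case 2
    then have "snd z = y (w ! j)" using edge_within_level e z by metis
    moreover have "y (w ! j') < snd z" "snd z < y (w ! k')"
      using edge_strictly_between_levels[OF e(2) 2(2) z(2) nz(3,4)] .
    ultimately have "w ! j' < w ! j" "w ! j < w ! k'" using y_less_iff l by auto
    then show False using 2 by simp
  next
    case 3
    then have "snd z = y (w ! j')" using edge_within_level e z by metis
    moreover have "y (w ! j) < snd z" "snd z < y (w ! k)"
      using edge_strictly_between_levels[OF e(1) 3(1) z(1) nz(1,2)] .
    ultimately have "w ! j < w ! j'" "w ! j' < w ! k" using y_less_iff l by auto
    then show False using 3 by simp
  next
    case 4
    obtain s where s: "0 < s" "s < 1" "fst z = (1 - s) * x j + s * x k"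
      "snd z = (1 - s) * y (w ! j) + s * y (w ! k)" "y (w ! j) < snd z" "snd z < y (w ! k)"
      using edge_between_levels[OF e(1) 4(1) z(1) nz(1,2)] by blast
    obtain t where t: "0 < t" "t < 1" "fst z = (1 - t) * x j' + t * x k'"
      "snd z = (1 - t) * y (w ! j') + t * y (w ! k')" "y (w ! j') < snd z" "snd z < y (w ! k')"
      using edge_between_levels[OF e(2) 4(2) z(2) nz(3,4)] by blast
    have "y (w ! j) < y (w ! k')" "y (w ! j') < y (w ! k)" using s t by auto
    then have "w ! j < w ! k'" "w ! j' < w ! k" using y_less_iff l by auto
    then have eq: "w ! j = w ! j'" using 4 by simp
    \<comment> \<open>Equal heights in one strip force equal parameters. By \<open>lt\<close>, the
      abscissas at that parameter then differ, because the ends are ordered alike and not all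
      equal.\<close>
    have "(y (w ! k) - y (w ! j)) * (s - t) = 0" using s(4) t(4) 4 eq by (simp add: algebra_simps)
    then have st: "s = t" using s by simp
    have lt: "(1 - t) * x a + t * x b < (1 - t) * x a' + t * x b'"
      if "w ! a = w ! a'" "w ! b = w ! b'" "a \<le> a'" "b \<le> b'" "a \<noteq> a' \<or> b \<noteq> b'"
        "a' < length w" "b' < length w" for a b a' b'
    proof -
      have xx: "x a \<le> x a'" "x b \<le> x b'" "x a < x a' \<or> x b < x b'"
        using that x_less[of a a'] x_less[of b b'] by (cases "a = a'"; cases "b = b'"; force)+
      have "(1 - t) * x a \<le> (1 - t) * x a'" "t * x b \<le> t * x b'"
        "(1 - t) * x a < (1 - t) * x a' \<or> t * x b < t * x b'"
        using xx t by (auto intro: mult_left_mono)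
      then show ?thesis by linarith
    qed
    have "j \<le> j' \<and> k \<le> k' \<or> j' \<le> j \<and> k' \<le> k"
      using between_levels_ordered[OF e(1) 4(1) e(2) 4(2) eq]
        between_levels_ordered[OF e(2) 4(2) e(1) 4(1) eq[symmetric]] by linarith
    then show False
      using lt[of j j' k k'] lt[of j' j k' k] s t st e(3) eq 4 l by auto
  qed
qed

lemma straight_line_drawing_place: "straight_line_drawing {..<length w} edge place"
  unfolding straight_line_drawing_def
proof (intro conjI allI impI inj_place)
  fix u v m assume *: "edge u v \<and> m \<in> {..<length w} \<and> m \<noteq> u \<and> m \<noteq> v"
  then show "place m \<notin> closed_segment (place u) (place v)"
    using upward_cases[of u v] place_notin_edge[of u v m] place_notin_edge[of v u m]
    by (auto simp: closed_segment_commute)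
next
  fix u v u' v' assume *: "edge u v \<and> edge u' v' \<and> {u, v} \<noteq> {u', v'}"
  have "place a \<notin> closed_segment (place u) (place v)"
    if "edge u v" "a < length w" "a \<notin> {u, v}" for u v a
    using that upward_cases[of u v] place_notin_edge[of u v a] place_notin_edge[of v u a]
    by (auto simp: closed_segment_commute)
  note vert = this
  show "closed_segment (place u) (place v) \<inter> closed_segment (place u') (place v')
      \<subseteq> place ` ({u, v} \<inter> {u', v'})"
  proof
    fix z assume z: "z \<in> closed_segment (place u) (place v) \<inter> closed_segment (place u') (place v')"
    have l: "u < length w" "v < length w" "u' < length w" "v' < length w"
      using * edgeD by auto
    show "z \<in> place ` ({u, v} \<inter> {u', v'})"
    proof (rule ccontr)
      assume nz: "z \<notin> place ` ({u, v} \<inter> {u', v'})"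
      \<comment> \<open>A vertex on an edge is one of its ends, so a vertex at \<open>z\<close>
        would be an end of both edges, which \<open>nz\<close> excludes.\<close>
      have "z \<noteq> place a" if "a \<in> {u, v} \<union> {u', v'}" for a
        using vert[of u v a] vert[of u' v' a] * z that l nz by auto
      then have n: "z \<noteq> place u" "z \<noteq> place v" "z \<noteq> place u'" "z \<noteq> place v'" by auto
      obtain j k where jk: "upward j k" "{j, k} = {u, v}"
        using upward_cases * by (metis insert_commute)
      obtain j' k' where jk': "upward j' k'" "{j', k'} = {u', v'}"
        using upward_cases * by (metis insert_commute)
      have "closed_segment (place u) (place v) = closed_segment (place j) (place k)"
        using jk(2) by (auto simp: doubleton_eq_iff closed_segment_commute)
      moreover have "closed_segment (place u') (place v') = closed_segment (place j') (place k')"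
        using jk'(2) by (auto simp: doubleton_eq_iff closed_segment_commute)
      ultimately have "z \<in> closed_segment (place j) (place k)" "z \<in> closed_segment (place j') (place k')"
        using z by (metis IntD1, metis IntD2)
      moreover have "(j, k) \<noteq> (j', k')" using jk(2) jk'(2) * by auto
      moreover have "{j, k} \<subseteq> {u, v}" "{j', k'} \<subseteq> {u', v'}" using jk(2) jk'(2) by simp_all
      then have "z \<noteq> place j" "z \<noteq> place k" "z \<noteq> place j'" "z \<noteq> place k'" using n by auto
      ultimately show False using edges_disjoint[OF jk(1) jk'(1)] by blast
    qed
  qed
qed

end

section \<open>Universal rows\<close>

text \<open>The interval between two consecutive partial sums has length \<open>a i\<close>, so it contains a multiple
  of the largest power of \<open>2\<close> that is at most \<open>a i\<close>.\<close>
lemma ex_universal_rows: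
  fixes a :: "nat \<Rightarrow> nat"
  assumes "\<And>i. i < m \<Longrightarrow> 1 \<le> a i"
  obtains \<rho> :: "nat \<Rightarrow> nat" where "\<And>i j. \<lbrakk>i < j; j < m\<rbrakk> \<Longrightarrow> \<rho> i < \<rho> j"
    "\<And>i. i < m \<Longrightarrow> 1 \<le> \<rho> i \<and> \<rho> i \<le> (\<Sum>i<m. a i)"
    "\<And>i. i < m \<Longrightarrow> \<exists>k. 2 ^ k dvd \<rho> i \<and> a i < 2 ^ Suc k"
proof -
  define s where "s i = (\<Sum>j<i. a j)" for i
  have s_mono: "s i \<le> s j" if "i \<le> j" for i j
    unfolding s_def using that by (intro sum_mono2) auto
  have "\<exists>r. s i < r \<and> r \<le> s (Suc i) \<and> (\<exists>k. 2 ^ k dvd r \<and> a i < 2 ^ Suc k)"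
    if im: "i < m" for i
  proof -
    obtain k where k: "2 ^ k \<le> a i" "a i < 2 ^ (k + 1)"
      using ex_power_ivl1[of 2 "a i"] assms[OF im] by auto
    define r where "r = s (Suc i) div 2 ^ k * 2 ^ k"
    have "r + s (Suc i) mod 2 ^ k = s (Suc i)"
      unfolding r_def by (rule div_mult_mod_eq)
    moreover have "s (Suc i) mod 2 ^ k < 2 ^ k" by simp
    moreover have "s (Suc i) = s i + a i" by (simp add: s_def)
    ultimately have "s i < r" "r \<le> s (Suc i)" using k by linarith+
    moreover have "2 ^ k dvd r" by (simp add: r_def)
    ultimately show ?thesis using k(2) by auto
  qed
  then obtain \<rho> where \<rho>: "\<And>i. i < m \<Longrightarrow> s i < \<rho> i \<and> \<rho> i \<le> s (Suc i) \<and>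
      (\<exists>k. 2 ^ k dvd \<rho> i \<and> a i < 2 ^ Suc k)"
    by metis
  have 1: "\<rho> i < \<rho> j" if "i < j" "j < m" for i j
    using \<rho>[of i] \<rho>[of j] s_mono[of "Suc i" j] that by auto
  have 2: "1 \<le> \<rho> i \<and> \<rho> i \<le> (\<Sum>i<m. a i)" if "i < m" for i
    using \<rho>[OF that] s_mono[of "Suc i" m] that by (auto simp: s_def)
  show thesis using that 1 2 \<rho> by blast
qed

text \<open>The bound \<open>2 ^ Suc k * l\<close> fits \<open>ex_universal_rows\<close>: the weight
  of a level is below \<open>2 ^ Suc k\<close>, and a unit of weight stands for \<open>l\<close>
  crossings. The height \<open>2 * l\<close> bounds the total weight.\<close>

definition grid_points :: "nat \<Rightarrow> nat \<Rightarrow> (nat \<times> nat) set" where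
  "grid_points l b = {(x, y). 1 \<le> x \<and> x \<le> b \<and> 1 \<le> y \<and> y \<le> 2 * l \<and>
     (\<exists>k. 2 ^ k dvd y \<and> x < 2 ^ Suc k * l)}"

lemma finite_grid_points: "finite (grid_points l b)"
  by (rule finite_subset[of _ "{..b} \<times> {..2 * l}"]) (auto simp: grid_points_def)

text \<open>At most \<open>2 * l div 2 ^ k\<close> rows are multiples of \<open>2 ^ k\<close>, and
  each is counted with fewer than \<open>2 ^ Suc k * l\<close> points, so the powers cancel. Only
  \<open>k < K\<close> occurs, since \<open>2 ^ k\<close> divides a row number that is at most
  \<open>2 * l\<close>.\<close>

lemma card_grid_points:
  assumes K: "2 * l < 2 ^ K"
  shows "card (grid_points l b) \<le> K * (4 * l\<^sup>2)"
proof -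
  define R where "R k = {1..<2 ^ Suc k * l} \<times> ((*) (2 ^ k) ` {1..2 * l div 2 ^ k})" for k :: nat
  have "grid_points l b \<subseteq> (\<Union>k<K. R k)"
  proof
    fix p assume "p \<in> grid_points l b"
    then obtain x y k where p: "p = (x, y)" "1 \<le> x" "1 \<le> y" "y \<le> 2 * l" "2 ^ k dvd y"
      "x < 2 ^ Suc k * l"
      by (auto simp: grid_points_def)
    obtain q where q: "y = 2 ^ k * q" using p(5) by (rule dvdE)
    then have "1 \<le> q" using p(3) by (cases q) auto
    moreover have "q \<le> 2 * l div 2 ^ k"
      using q p(4) by (metis div_le_mono nonzero_mult_div_cancel_left power_not_zero zero_neq_numeral)
    moreover have "2 ^ k < (2::nat) ^ K"
      using K p(3-5) by (meson dvd_imp_le le_less_trans less_le_trans zero_less_one)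
    then have "k < K" by simp
    ultimately show "p \<in> (\<Union>k<K. R k)" using p q by (auto simp: R_def)
  qed
  moreover have "finite (\<Union>k<K. R k)" by (auto simp: R_def)
  ultimately have "card (grid_points l b) \<le> card (\<Union>k<K. R k)" by (simp add: card_mono)
  also have "\<dots> \<le> (\<Sum>k<K. card (R k))" by (rule card_UN_le) simp
  also have "\<dots> \<le> (\<Sum>k<K. 4 * l\<^sup>2)"
  proof (rule sum_mono)
    fix k
    have "card ((*) (2 ^ k) ` {1..2 * l div 2 ^ k}) \<le> 2 * l div 2 ^ k"
      using card_image_le[of "{1..2 * l div 2 ^ k}"] by simp
    then have "card (R k) \<le> 2 ^ Suc k * l * (2 * l div 2 ^ k)"
      unfolding R_def card_cartesian_product by (intro mult_le_mono) auto
    also have "\<dots> = 2 * l * (2 ^ k * (2 * l div 2 ^ k))" by simp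
    also have "\<dots> \<le> 2 * l * (2 * l)" by (intro mult_le_mono2) (simp add: times_div_less_eq_dividend)
    finally show "card (R k) \<le> 4 * l\<^sup>2" by (simp add: power2_eq_square)
  qed
  finally show ?thesis by simp
qed

text \<open>The constant is \<open>4 * 4 * 3\<close>, from \<open>k + 1 <= 4 * ln l\<close> and
  \<open>l * l <= 3 * n\<close>. As \<open>l\<close> exceeds Euler's number,
  \<open>ln l >= 1\<close> absorbs the additive constants.\<close>

lemma card_grid_points_le:
  assumes l: "3 \<le> l" and n: "n = l * (l - 1) div 2"
  shows "real (card (grid_points l b)) \<le> 48 * real n * ln (real n)"
proof -
  obtain k where k: "2 ^ k \<le> 2 * l" "2 * l < 2 ^ (k + 1)"
    using ex_power_ivl1[of 2 "2 * l"] l by auto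
  have "ln (exp 1) \<le> ln (real l)" using exp_le l by (subst ln_le_cancel_iff) auto
  then have ln: "1 \<le> ln (real l)" by simp
  have "real (2 ^ k) \<le> real (2 * l)" using k(1) by (rule of_nat_mono)
  then have "ln (2 ^ k) \<le> ln (2 * real l)" using l by (subst ln_le_cancel_iff) auto
  then have "real k * ln 2 \<le> ln 2 + ln (real l)" using l by (simp add: ln_mult ln_realpow)
  then have "(real k - 1) * ln 2 \<le> ln (real l)" by (simp add: algebra_simps)
  moreover have "(real k - 1) * (1 / 2) \<le> (real k - 1) * ln 2" if "1 \<le> k"
    using ln2_ge_two_thirds that by (intro mult_left_mono) auto
  ultimately have "real k - 1 \<le> 2 * ln (real l)" using ln by (cases "1 \<le> k") auto
  then have k4: "real k + 1 \<le> 4 * ln (real l)" using ln by linarith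
  have "even (l * (l - 1))" by (cases l) auto
  then have "real n = real (l * (l - 1)) / 2" unfolding n by (simp add: real_of_nat_div)
  also have "\<dots> = real l * (real l - 1) / 2" using l by simp
  finally have rn: "real n = real l * (real l - 1) / 2" .
  have "real l * 2 \<le> real l * (real l - 1)" using l by (intro mult_left_mono) auto
  then have "real l \<le> real n" using rn by simp
  then have lnn: "ln (real l) \<le> ln (real n)" using l by (subst ln_le_cancel_iff) auto
  have "real l * 3 \<le> real l * real l" using l by (intro mult_left_mono) auto
  then have l2: "(real l)\<^sup>2 \<le> 3 * real n" by (simp add: rn power2_eq_square algebra_simps)
  have "real (card (grid_points l b)) \<le> real ((k + 1) * (4 * l\<^sup>2))"
    using card_grid_points[OF k(2)] by (rule of_nat_mono)
  also have "\<dots> = 4 * (real k + 1) * (real l)\<^sup>2" by (simp add: algebra_simps)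
  also have "\<dots> \<le> 4 * (4 * ln (real l)) * (3 * real n)"
    using k4 l2 ln by (intro mult_mono) auto
  also have "\<dots> = 48 * real n * ln (real l)" by simp
  also have "\<dots> \<le> 48 * real n * ln (real n)" using lnn by (intro mult_left_mono) auto
  finally show ?thesis .
qed

section \<open>Numbering lines by their sides\<close>

text \<open>The assumption \<open>sides\<close> says that the side of \<open>P\<close> on which \<open>Q\<close> and \<open>R\<close> cross can be read off
  along \<open>Q\<close> as well as along \<open>R\<close>.\<close>
locale signed_lines =
  fixes A :: "'a set" and pos :: "'a \<Rightarrow> 'a \<Rightarrow> real" and above :: "'a \<Rightarrow> 'a \<Rightarrow> bool"
  assumes pos_neq: "\<lbrakk>P \<in> A; Q \<in> A; R \<in> A; Q \<noteq> P; R \<noteq> P; Q \<noteq> R\<rbrakk> \<Longrightarrow> pos P Q \<noteq> pos P R"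
    and sides: "\<lbrakk>P \<in> A; Q \<in> A; R \<in> A; Q \<noteq> P; R \<noteq> P; Q \<noteq> R\<rbrakk> \<Longrightarrow>
      (pos Q R < pos Q P \<longleftrightarrow> above P Q) \<longleftrightarrow> (pos R Q < pos R P \<longleftrightarrow> above P R)"
begin

lemma not_less_pos: "\<lbrakk>P \<in> A; Q \<in> A; R \<in> A; Q \<noteq> P; R \<noteq> P; Q \<noteq> R\<rbrakk> \<Longrightarrow>
    pos P R < pos P Q \<longleftrightarrow> \<not> pos P Q < pos P R"
  using pos_neq[of P Q R] by auto

text \<open>Reversing \<open>Q\<close> negates all comparisons along \<open>Q\<close> and the side
  of every line on which \<open>Q\<close> starts; exchanging the sides of \<open>P\<close> negates
  \<open>above P\<close> throughout. Both readings in \<open>sides\<close> change alike.\<close>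

lemma signed_lines_flip:
  "signed_lines A (\<lambda>P Q. if flip P then - pos P Q else pos P Q)
     (\<lambda>P Q. above P Q \<noteq> (flip Q \<noteq> swap P))"
proof
  fix P Q R assume *: "P \<in> A" "Q \<in> A" "R \<in> A" "Q \<noteq> P" "R \<noteq> P" "Q \<noteq> R"
  show "(if flip P then - pos P Q else pos P Q) \<noteq> (if flip P then - pos P R else pos P R)"
    using pos_neq[of P Q R] * by auto
  show "((if flip Q then - pos Q R else pos Q R) < (if flip Q then - pos Q P else pos Q P)
       \<longleftrightarrow> (above P Q \<noteq> (flip Q \<noteq> swap P))) \<longleftrightarrow>
     ((if flip R then - pos R Q else pos R Q) < (if flip R then - pos R P else pos R P)
       \<longleftrightarrow> (above P R \<noteq> (flip R \<noteq> swap P)))"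
    using sides[of P Q R] not_less_pos[of Q R P] not_less_pos[of R Q P] * by auto
qed

end

text \<open>After reversing lines and exchanging their sides, every line starts above the reference
  line \<open>Z\<close> and \<open>Z\<close> starts below every other line.\<close>
locale normalized_lines = signed_lines +
  fixes Z
  assumes Z: "Z \<in> A"
    and above_Z: "\<lbrakk>P \<in> A; P \<noteq> Z\<rbrakk> \<Longrightarrow> above Z P"
    and Z_below: "\<lbrakk>P \<in> A; P \<noteq> Z\<rbrakk> \<Longrightarrow> \<not> above P Z"
begin

text \<open>For lines other than \<open>Z\<close>, taking each of \<open>P\<close>,
  \<open>Q\<close>, \<open>Z\<close> in turn as the reference of \<open>sides\<close> determines
  \<open>above P Q\<close> and \<open>above Q P\<close> from the orders of the three crossings, with
  opposite outcomes.\<close>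

lemma above_antisym:
  assumes "P \<in> A" "Q \<in> A" "P \<noteq> Q"
  shows "above P Q \<longleftrightarrow> \<not> above Q P"
proof (cases "P = Z \<or> Q = Z")
  case True
  then show ?thesis using assms above_Z Z_below by auto
next
  case False
  then show ?thesis
    using assms Z above_Z[of P] above_Z[of Q] Z_below[of P] Z_below[of Q]
      sides[of Z P Q] sides[of P Q Z] sides[of Q Z P]
      not_less_pos[of P Q Z] not_less_pos[of Q P Z] not_less_pos[of Z P Q]
    by simp blast
qed

text \<open>With the three values of \<open>above\<close> fixed, the instances of
  \<open>sides\<close> become the condition \<open>triple\<close> of
  \<open>local_sequences\<close>.\<close>

lemma above_triple:
  assumes "P \<in> A" "Q \<in> A" "R \<in> A" "above P Q" "above Q R" "above P R"
    "P \<noteq> Q" "Q \<noteq> R" "P \<noteq> R"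
  shows "pos P Q < pos P R \<longleftrightarrow> pos Q P < pos Q R" "pos P Q < pos P R \<longleftrightarrow> pos R P < pos R Q"
proof -
  have "\<not> above Q P" "\<not> above R Q" "\<not> above R P"
    using above_antisym[of P Q] above_antisym[of Q R] above_antisym[of P R] assms by simp_all
  then have "(pos P Q < pos P R \<longleftrightarrow> pos Q P < pos Q R) \<and> (pos P Q < pos P R \<longleftrightarrow> pos R P < pos R Q)"
    using assms sides[of P Q R] sides[of Q P R] sides[of R P Q]
      not_less_pos[of P Q R] not_less_pos[of Q P R] not_less_pos[of R P Q]
    by simp
  then show "pos P Q < pos P R \<longleftrightarrow> pos Q P < pos Q R" "pos P Q < pos P R \<longleftrightarrow> pos R P < pos R Q"
    by auto
qed

text \<open>A cycle is excluded by \<open>Z\<close>: \<open>above_triple\<close> applies to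
  \<open>Z\<close> with each pair of the cycle, and combined with \<open>cyc\<close> it makes the
  comparisons of \<open>P\<close> with \<open>Q\<close>, \<open>Q\<close> with \<open>R\<close> and
  \<open>R\<close> with \<open>P\<close> along \<open>Z\<close> equivalent, which no linear order
  allows.\<close>

lemma above_trans:
  assumes "P \<in> A" "Q \<in> A" "R \<in> A" "above P Q" "above Q R" "P \<noteq> Q" "Q \<noteq> R" "P \<noteq> R"
  shows "above P R"
proof (rule ccontr)
  assume "\<not> above P R"
  then have RP: "above R P" using above_antisym[of P R] assms by simp
  have Z3: "P \<noteq> Z" "Q \<noteq> Z" "R \<noteq> Z"
    using Z_below[of P] Z_below[of Q] Z_below[of R] assms RP by auto
  have cyc: "pos P Q < pos P R \<longleftrightarrow> pos Q R < pos Q P" "pos Q R < pos Q P \<longleftrightarrow> pos R P < pos R Q"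
    using assms RP above_antisym[of P Q] above_antisym[of Q R] above_antisym[of P R]
      sides[of P Q R] sides[of Q P R] sides[of R P Q]
      not_less_pos[of P Q R] not_less_pos[of Q P R] not_less_pos[of R P Q]
    by simp_all
  have t: "pos Z P < pos Z Q \<longleftrightarrow> pos P Z < pos P Q" "pos Z P < pos Z Q \<longleftrightarrow> pos Q Z < pos Q P"
    "pos Z Q < pos Z R \<longleftrightarrow> pos Q Z < pos Q R" "pos Z Q < pos Z R \<longleftrightarrow> pos R Z < pos R Q"
    "pos Z R < pos Z P \<longleftrightarrow> pos R Z < pos R P" "pos Z R < pos Z P \<longleftrightarrow> pos P Z < pos P R"
    using above_triple[of Z P Q] above_triple[of Z Q R] above_triple[of Z R P] above_Z Z assms RP Z3
    by auto
  have n: "pos Z P \<noteq> pos Z Q" "pos Z Q \<noteq> pos Z R" "pos Z R \<noteq> pos Z P"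
    using pos_neq Z Z3 assms by auto
  \<comment> \<open>Transitivity along a single line, in the propositional form needed to chain the
    equivalences.\<close>
  have o: "pos P Z < pos P Q \<Longrightarrow> pos P Q < pos P R \<Longrightarrow> pos P Z < pos P R"
    "\<not> pos P Z < pos P Q \<Longrightarrow> \<not> pos P Q < pos P R \<Longrightarrow> \<not> pos P Z < pos P R"
    "pos Q Z < pos Q R \<Longrightarrow> pos Q R < pos Q P \<Longrightarrow> pos Q Z < pos Q P"
    "\<not> pos Q Z < pos Q R \<Longrightarrow> \<not> pos Q R < pos Q P \<Longrightarrow> \<not> pos Q Z < pos Q P"
    "pos R Z < pos R P \<Longrightarrow> pos R P < pos R Q \<Longrightarrow> pos R Z < pos R Q"
    "\<not> pos R Z < pos R P \<Longrightarrow> \<not> pos R P < pos R Q \<Longrightarrow> \<not> pos R Z < pos R Q"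
    by linarith+
  have "pos Z P < pos Z Q \<longleftrightarrow> pos Z R < pos Z P" "pos Z R < pos Z P \<longleftrightarrow> pos Z Q < pos Z R"
    using o t cyc by blast+
  then show False using n by linarith
qed

text \<open>On distinct lines \<open>above\<close> is a strict linear order, so the number of
  predecessors is a bijection onto \<open>{..<card A}\<close>; its inverse is the numbering.\<close>

lemma ex_numbering:
  assumes "finite A"
  shows "\<exists>f. bij_betw f {..<card A} A \<and>
    (\<forall>i j. i < j \<longrightarrow> j < card A \<longrightarrow> f i \<noteq> f j \<and> above (f i) (f j))"
proof -
  define r where "r P = card {Q \<in> A. Q \<noteq> P \<and> above Q P}" for P
  have less: "r P < r Q" if "P \<in> A" "Q \<in> A" "P \<noteq> Q" "above P Q" for P Q
    unfolding r_def
  proof (rule psubset_card_mono)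
    show "finite {S \<in> A. S \<noteq> Q \<and> above S Q}" using assms by simp
    have "{S \<in> A. S \<noteq> P \<and> above S P} \<subseteq> {S \<in> A. S \<noteq> Q \<and> above S Q}"
      using that above_trans[of _ P Q] above_antisym[of P Q] by auto
    then show "{S \<in> A. S \<noteq> P \<and> above S P} \<subset> {S \<in> A. S \<noteq> Q \<and> above S Q}"
      using that by blast
  qed
  have inj: "inj_on r A"
    by (rule inj_onI) (metis less above_antisym less_irrefl)
  have "r ` A \<subseteq> {..<card A}"
  proof
    fix i assume "i \<in> r ` A"
    then obtain P where P: "P \<in> A" "i = r P" by blast
    then have "r P < card A"
      unfolding r_def using assms by (intro psubset_card_mono) auto
    then show "i \<in> {..<card A}" using P by simp
  qed
  then have "r ` A = {..<card A}"
    using inj by (intro card_subset_eq) (auto simp: card_image)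
  then have bij: "bij_betw r A {..<card A}" using inj by (simp add: bij_betw_def)
  define f where "f = inv_into A r"
  have f: "bij_betw f {..<card A} A" unfolding f_def using bij by (rule bij_betw_inv_into)
  have rf: "r (f i) = i" "f i \<in> A" if "i < card A" for i
    using bij that f bij_betw_inv_into_right[OF bij, of i]
    by (auto simp: f_def bij_betw_def)
  have "f i \<noteq> f j \<and> above (f i) (f j)" if "i < j" "j < card A" for i j
    using rf[of i] rf[of j] that above_antisym[of "f i" "f j"] less[of "f j" "f i"]
    by (metis less_asym less_trans nat_neq_iff)
  then show ?thesis using f by blast
qed

lemma ex_local_sequences:
  assumes "finite A"
  shows "\<exists>f. bij_betw f {..<card A} A \<and> local_sequences (card A) (\<lambda>i j. pos (f i) (f j))"
proof -
  obtain f where f: "bij_betw f {..<card A} A"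
    and ab: "\<And>i j. \<lbrakk>i < j; j < card A\<rbrakk> \<Longrightarrow> f i \<noteq> f j \<and> above (f i) (f j)"
    using ex_numbering[OF assms] by blast
  have A: "f i \<in> A" if "i < card A" for i using f that by (auto simp: bij_betw_def)
  have ne: "f i \<noteq> f j" if "i < card A" "j < card A" "i \<noteq> j" for i j
    using f that by (auto simp: bij_betw_def inj_on_def)
  have "local_sequences (card A) (\<lambda>i j. pos (f i) (f j))"
  proof
    show "pos (f i) (f j) \<noteq> pos (f i) (f k)"
      if "i < card A" "j < card A" "k < card A" "j \<noteq> i" "k \<noteq> i" "j \<noteq> k" for i j k
      using that A ne by (intro pos_neq) auto
    show "(pos (f i) (f j) < pos (f i) (f k) \<longleftrightarrow> pos (f j) (f i) < pos (f j) (f k)) \<and>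
        (pos (f i) (f j) < pos (f i) (f k) \<longleftrightarrow> pos (f k) (f i) < pos (f k) (f j))"
      if "i < j" "j < k" "k < card A" for i j k
      using above_triple[of "f i" "f j" "f k"] A[of i] A[of j] A[of k] ab[of i j] ab[of j k] ab[of i k]
        that by simp
  qed
  then show ?thesis using f by blast
qed

end

lemma (in signed_lines) ex_oriented_numbering:
  assumes "finite A"
  shows "\<exists>f flip. bij_betw f {..<card A} A \<and>
    local_sequences (card A) (\<lambda>i j. if flip (f i) then - pos (f i) (f j) else pos (f i) (f j))"
proof (cases "A = {}")
  case True
  then show ?thesis by (auto simp: local_sequences_def bij_betw_def)
next
  case False
  then obtain Z where Z: "Z \<in> A" by blast
  \<comment> \<open>Since \<open>Z\<close> is neither reversed nor has its sides exchanged,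
    reversing \<open>P\<close> corrects \<open>above Z P\<close> and exchanging the sides of
    \<open>P\<close> corrects \<open>above P Z\<close>, independently of each other.\<close>
  define flip where "flip P \<longleftrightarrow> P \<noteq> Z \<and> \<not> above Z P" for P
  define swap where "swap P \<longleftrightarrow> P \<noteq> Z \<and> above P Z" for P
  interpret flipped: normalized_lines A "\<lambda>P Q. if flip P then - pos P Q else pos P Q"
    "\<lambda>P Q. above P Q \<noteq> (flip Q \<noteq> swap P)" Z
    by (intro normalized_lines.intro signed_lines_flip normalized_lines_axioms.intro Z)
      (auto simp: flip_def swap_def)
  show ?thesis using flipped.ex_local_sequences[OF assms] by blast
qed

section \<open>Crossing pseudolines\<close>

lemma homeomorphismD:
  assumes "homeomorphism S T f g"
  shows "x \<in> S \<Longrightarrow> g (f x) = x" "y \<in> T \<Longrightarrow> f (g y) = y" "f ` S = T" "g ` T = S"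
    "continuous_on T g" "continuous_on S f"
  using assms by (auto simp: homeomorphism_def)

lemma sign_constant_on_connected:
  fixes f :: "'a::topological_space \<Rightarrow> real"
  assumes "connected S" "continuous_on S f" "\<And>z. z \<in> S \<Longrightarrow> f z \<noteq> 0" "a \<in> S" "0 < f a" "b \<in> S"
  shows "0 < f b"
proof (rule ccontr)
  assume "\<not> 0 < f b"
  then have "f b < 0" using assms(3)[OF assms(6)] by simp
  moreover have "connected (f ` S)" using assms(1,2) by (rule connected_continuous_image[rotated])
  ultimately have "0 \<in> f ` S"
    using connectedD_interval[of "f ` S" "f b" "f a" 0] assms by auto
  then show False using assms(3) by auto
qed

text \<open>Near a crossing, the complement of \<open>P\<close> consists of two half discs, and each of them contains
  points of \<open>Q\<close>.\<close>
lemma crossing_one_sided: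
  fixes f :: "point \<Rightarrow> real"
  assumes cr: "is_crossing P Q p" and f: "continuous_on UNIV f" "\<And>z. f z = 0 \<longleftrightarrow> z \<in> P"
    and Q: "\<And>z. z \<in> Q \<Longrightarrow> z \<noteq> p \<Longrightarrow> 0 < f z"
  obtains W where "open W" "p \<in> W" "\<And>z. z \<in> W \<Longrightarrow> 0 \<le> f z"
proof -
  obtain W and \<phi> \<psi> :: "point \<Rightarrow> point" where W: "open W" "p \<in> W"
    and hom: "homeomorphism W (ball 0 1) \<phi> \<psi>" and 0: "\<phi> p = 0"
    and P_img: "\<phi> ` (P \<inter> W) = {z \<in> ball 0 1. snd z = 0}"
    and Q_img: "\<phi> ` (Q \<inter> W) = {z \<in> ball 0 1. fst z = 0}"
    using cr by (auto simp: is_crossing_def)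
  note hom = homeomorphismD[OF hom]
  have half: "0 < f (\<psi> z)"
    if c: "convex H" and H: "H = {z \<in> ball 0 1. 0 < s * snd z}" and s: "\<bar>s\<bar> = 1" and z: "z \<in> H"
    for H s z
  proof (rule sign_constant_on_connected[where f = f and S = "\<psi> ` H"])
    have sub: "H \<subseteq> ball 0 1" using H by auto
    have "continuous_on H \<psi>" using hom(5) sub continuous_on_subset by blast
    then show "connected (\<psi> ` H)" using c convex_connected connected_continuous_image by blast
    show "continuous_on (\<psi> ` H) f" using f(1) continuous_on_subset by blast
    show "f x \<noteq> 0" if x: "x \<in> \<psi> ` H" for x
    proof
      assume "f x = 0"
      obtain y where y: "y \<in> H" "x = \<psi> y" using x by blast
      then have "x \<in> P \<inter> W" using \<open>f x = 0\<close> f(2) hom(4) sub by auto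
      then have "snd (\<phi> x) = 0" using P_img by auto
      then show False using y hom(2) sub H by auto
    qed
    \<comment> \<open>This point of the half disc lies on the vertical axis, the image of
      \<open>Q\<close>, so \<open>f\<close> is positive at its preimage.\<close>
    have h: "(0, s / 2) \<in> ball (0::point) 1" using s by (simp add: norm_Pair)
    then have "(0, s / 2) \<in> \<phi> ` (Q \<inter> W)" unfolding Q_img by simp
    then obtain q where q: "q \<in> Q" "q \<in> W" "\<phi> q = (0, s / 2)" by force
    have "\<psi> (0, s / 2) = q" using q hom(1) by metis
    moreover have "q \<noteq> p" using q 0 s by (auto simp: zero_prod_def)
    ultimately show "0 < f (\<psi> (0, s / 2))" using Q q by simp
    have "s * s = 1" using s by (metis abs_mult_self_eq mult_1)
    then have "(0, s / 2) \<in> H" using h H by simp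
    then show "\<psi> (0, s / 2) \<in> \<psi> ` H" by blast
    show "\<psi> z \<in> \<psi> ` H" using z by simp
  qed
  have conv: "convex {z \<in> ball (0::point) 1. 0 < s * snd z}" for s
  proof -
    have "{z \<in> ball (0::point) 1. 0 < s * snd z} = ball 0 1 \<inter> {z. inner (0, s) z > 0}"
      by (auto simp: inner_prod_def)
    then show ?thesis using convex_Int[OF convex_ball convex_halfspace_gt] by simp
  qed
  have "0 \<le> f z" if z: "z \<in> W" for z
  proof -
    have b: "\<phi> z \<in> ball 0 1" "\<psi> (\<phi> z) = z" using hom(1,3) z by auto
    consider "snd (\<phi> z) = 0" | "0 < 1 * snd (\<phi> z)" | "0 < - 1 * snd (\<phi> z)" by linarith
    then show ?thesis
    proof cases
      case 1
      then have "\<phi> z \<in> \<phi> ` (P \<inter> W)" using b P_img by simp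
      then obtain y where y: "y \<in> P" "y \<in> W" "\<phi> z = \<phi> y" by blast
      have "z = \<psi> (\<phi> y)" using b(2) y(3) by simp
      also have "\<dots> = y" using hom(1) y(2) .
      finally have "z = y" .
      then show ?thesis using f(2)[of z] y by simp
    next
      case 2
      then have "0 < f (\<psi> (\<phi> z))" by (intro half[OF conv[of 1] refl]) (use b in auto)
      then show ?thesis using b by simp
    next
      case 3
      then have "0 < f (\<psi> (\<phi> z))" by (intro half[OF conv[of "-1"] refl]) (use b in auto)
      then show ?thesis using b by simp
    qed
  qed
  then show thesis using W that by blast
qed

text \<open>Otherwise \<open>crossing_one_sided\<close> puts a whole neighbourhood of
  \<open>p\<close> weakly on one side of \<open>P\<close>, but \<open>h\<close> carries points just
  across the axis into that neighbourhood.\<close>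

lemma crossing_not_one_sided:
  assumes cr: "is_crossing P Q p" and hg: "homeomorphism UNIV UNIV h g" "P = h ` xaxis"
    and s: "\<bar>s\<bar> = 1" and Q: "\<And>z. z \<in> Q \<Longrightarrow> z \<noteq> p \<Longrightarrow> 0 < s * snd (g z)"
  shows False
proof -
  note hom = homeomorphismD[OF hg(1)]
  have hom1: "g (h z) = z" "h (g z) = z" for z using hom by auto
  have "continuous_on UNIV g" "continuous_on UNIV h" using hom by auto
  then have cont: "continuous_on UNIV (\<lambda>z. s * snd (g z))" by (intro continuous_intros)
  have P: "s * snd (g z) = 0 \<longleftrightarrow> z \<in> P" for z
  proof -
    have "z \<in> P \<longleftrightarrow> g z \<in> xaxis" using hg(2) hom1 by (metis imageE imageI)
    then show ?thesis using s by (auto simp: xaxis_def)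
  qed
  obtain W where W: "open W" "p \<in> W" "\<And>z. z \<in> W \<Longrightarrow> 0 \<le> s * snd (g z)"
    using crossing_one_sided[OF cr cont P Q] by blast
  have "p \<in> P" using cr by (auto simp: is_crossing_def)
  then have p0: "snd (g p) = 0" using P[of p] s by auto
  have "open (h -` W)" using W(1) \<open>continuous_on UNIV h\<close> by (simp add: open_vimage)
  moreover have "g p \<in> h -` W" using W(2) hom1 by simp
  ultimately obtain e where e: "0 < e" "ball (g p) e \<subseteq> h -` W" by (metis open_contains_ball)
  define y where "y = (fst (g p), - s * e / 2)"
  have "dist (g p) y = e / 2"
    using p0 s e(1) by (simp add: y_def dist_prod_def dist_real_def abs_mult prod_eq_iff)
  then have "y \<in> ball (g p) e" using e(1) by simp
  then have "h y \<in> W" using e(2) by auto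
  then have "0 \<le> s * snd y" using W(3)[of "h y"] hom1 by simp
  then have "0 \<le> - (s * s) * e / 2" by (simp add: y_def)
  moreover have "s * s = 1" using s by (metis abs_mult_self_eq mult_1)
  ultimately show False using e(1) by simp
qed

text \<open>The inner quantifier rebinds \<open>r\<close> and says that \<open>Q\<close> starts on
  the positive side of \<open>P\<close>. Off \<open>t\<close> the second coordinate is nonzero, so
  its sign is constant on each ray; equal signs would contradict
  \<open>crossing_not_one_sided\<close>.\<close>

lemma crossing_changes_side:
  assumes cr: "is_crossing P Q (k (t, 0))" and PQ: "P \<inter> Q = {k (t, 0)}"
    and hg: "homeomorphism UNIV UNIV h g" "P = h ` xaxis"
    and km: "homeomorphism UNIV UNIV k m" "Q = k ` xaxis"
    and ne: "r \<noteq> t"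
  shows "0 < snd (g (k (r, 0))) \<longleftrightarrow> (r < t \<longleftrightarrow> (\<forall>r<t. 0 < snd (g (k (r, 0)))))"
proof -
  define f where "f r = snd (g (k (r, 0)))" for r
  have gh: "g (h z) = z" "h (g z) = z" for z using homeomorphismD[OF hg(1)] by auto
  have mk: "m (k z) = z" for z using homeomorphismD[OF km(1)] by auto
  have cont: "continuous_on UNIV g" "continuous_on UNIV k"
    using homeomorphismD[OF hg(1)] homeomorphismD[OF km(1)] by auto
  have cf: "continuous_on X f" for X
    unfolding f_def
    by (intro continuous_intros continuous_on_compose2[OF cont(1)] continuous_on_compose2[OF cont(2)]) auto
  have f0: "f r \<noteq> 0" if "r \<noteq> t" for r
  proof
    assume "f r = 0"
    then have "g (k (r, 0)) \<in> xaxis" by (simp add: f_def xaxis_def)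
    then have "h (g (k (r, 0))) \<in> P" using hg(2) by blast
    then have "k (r, 0) \<in> P" by (simp add: gh)
    moreover have "k (r, 0) \<in> Q" using km(2) by (auto simp: xaxis_def)
    ultimately have "k (r, 0) = k (t, 0)" using PQ by blast
    then show False using mk that by (metis fst_conv)
  qed
  have cst: "0 < s * f b" if "connected X" "t \<notin> X" "a \<in> X" "b \<in> X" "0 < s * f a" "\<bar>s\<bar> = 1" for X a b s
  proof (rule sign_constant_on_connected[of X "\<lambda>r. s * f r" a b])
    show "continuous_on X (\<lambda>r. s * f r)" by (intro continuous_intros cf)
    show "s * f z \<noteq> 0" if "z \<in> X" for z using that f0[of z] \<open>t \<notin> X\<close> \<open>\<bar>s\<bar> = 1\<close> by auto
  qed (use that in auto)
  have left: "0 < s * f b" if "0 < s * f a" "a < t" "b < t" "\<bar>s\<bar> = 1" for s a b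
    using cst[of "{..<t}" a b s] that by auto
  have right: "0 < s * f b" if "0 < s * f a" "t < a" "t < b" "\<bar>s\<bar> = 1" for s a b
    using cst[of "{t<..}" a b s] that by auto
  have no: False if s: "\<bar>s\<bar> = 1" and "0 < s * f a" "a < t" "0 < s * f b" "t < b" for s a b
  proof (rule crossing_not_one_sided[OF cr hg s])
    fix z assume z: "z \<in> Q" "z \<noteq> k (t, 0)"
    then obtain y where y: "y \<in> xaxis" "z = k y" using km(2) by blast
    define r where "r = fst y"
    have "y = (r, 0)" using y(1) by (simp add: r_def xaxis_def prod_eq_iff)
    then have r: "z = k (r, 0)" using y(2) by simp
    then have "r \<noteq> t" using z by blast
    then have "0 < s * f r"
      using r left[of s a r] right[of s b r] that by (cases "r < t") auto
    then show "0 < s * snd (g z)" using r by (simp add: f_def)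
  qed
  show ?thesis
  proof (cases "\<forall>r<t. 0 < f r")
    case True
    then show ?thesis
      using no[of 1 "t - 1" r] ne by (cases "r < t") (auto simp: f_def)
  next
    case False
    then obtain a where "a < t" "\<not> 0 < f a" by blast
    then have a: "a < t" "0 < (- 1) * f a" using f0[of a] by auto
    have "\<not> 0 < f r \<longleftrightarrow> r < t"
    proof (cases "r < t")
      case True
      then show ?thesis using left[of "-1" a r] a by simp
    next
      case False
      then show ?thesis using no[of "-1" a r] a ne f0[OF ne] by force
    qed
    then show ?thesis using False by (auto simp: f_def)
  qed
qed

text \<open>\<open>consecutive_on\<close> may use a parametrization other than \<open>h\<close>. The
  transition map \<alpha> is continuous, so the image of \<open>{s..t}\<close> covers the segment,
  and interior points come from interior parameters.\<close>

lemma consecutive_on_parametrization: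
  assumes "consecutive_on A P u v" and hg: "homeomorphism UNIV UNIV h g" "P = h ` xaxis"
  shows "u \<in> P" "v \<in> P"
    "\<And>r. r \<in> open_segment (fst (g u)) (fst (g v)) \<Longrightarrow> h (r, 0) \<notin> pa_vertices A"
proof -
  obtain k m s t where km: "homeomorphism UNIV UNIV k m" "P = k ` xaxis" and "s < t"
    and u: "u = k (s, 0)" and v: "v = k (t, 0)"
    and btw: "\<And>r. \<lbrakk>s < r; r < t\<rbrakk> \<Longrightarrow> k (r, 0) \<notin> pa_vertices A"
    using assms(1) unfolding consecutive_on_def by blast
  have kP: "k (r, 0) \<in> P" for r using km(2) by (auto simp: xaxis_def)
  then show "u \<in> P" "v \<in> P" using u v by auto
  have gh: "g (h z) = z" "h (g z) = z" for z using homeomorphismD[OF hg(1)] by auto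
  have cont: "continuous_on UNIV g" "continuous_on UNIV k"
    using homeomorphismD[OF hg(1)] homeomorphismD[OF km(1)] by auto
  define \<alpha> where "\<alpha> r = fst (g (k (r, 0)))" for r
  have c\<alpha>: "continuous_on X \<alpha>" for X
    unfolding \<alpha>_def
    by (intro continuous_intros continuous_on_compose2[OF cont(1)] continuous_on_compose2[OF cont(2)]) auto
  have h\<alpha>: "h (\<alpha> r, 0) = k (r, 0)" for r
  proof -
    obtain x where "k (r, 0) = h (x, 0)" using kP[of r] hg(2) by (auto simp: xaxis_def)
    then show ?thesis using gh by (simp add: \<alpha>_def)
  qed
  fix r assume r: "r \<in> open_segment (fst (g u)) (fst (g v))"
  then have r': "r \<in> closed_segment (\<alpha> s) (\<alpha> t)" "r \<noteq> \<alpha> s" "r \<noteq> \<alpha> t"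
    by (auto simp: \<alpha>_def u v open_segment_def)
  have "connected (\<alpha> ` {s..t})" using c\<alpha> by (intro connected_continuous_image) auto
  then have "closed_segment (\<alpha> s) (\<alpha> t) \<subseteq> \<alpha> ` {s..t}"
    using \<open>s < t\<close> by (intro closed_segment_subset) (auto simp: is_interval_connected_1 is_interval_convex)
  then obtain q where q: "q \<in> {s..t}" "r = \<alpha> q" using r'(1) by blast
  then have "s < q" "q < t" using r' by (auto simp: less_le)
  then show "h (r, 0) \<notin> pa_vertices A" using btw q h\<alpha> by simp
qed

section \<open>Pseudoline arrangements\<close>

lemma card_line_pairs: "card (line_pairs n) = n * (n - 1) div 2"
proof (induction n)
  case 0
  then show ?case by (simp add: line_pairs_def)
next
  case (Suc n)
  have fin: "finite (line_pairs n)"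
    by (rule finite_subset[of _ "Pow {..<n}"]) (auto simp: line_pairs_def)
  have "inj_on (\<lambda>i. {i, n}) {..<n}" by (auto simp: inj_on_def doubleton_eq_iff)
  moreover have "line_pairs n \<inter> (\<lambda>i. {i, n}) ` {..<n} = {}" by (auto simp: in_line_pairs)
  ultimately have "card (line_pairs (Suc n)) = n * (n - 1) div 2 + n"
    using fin Suc.IH by (simp add: line_pairs_Suc card_Un_disjoint card_image)
  also have "\<dots> = Suc n * (Suc n - 1) div 2" by (cases n) auto
  finally show ?case .
qed

text \<open>The vertex count determines the number of lines, except that \<open>0\<close> and
  \<open>1\<close> lines both give no vertex; hence the bound on \<open>l\<close>.\<close>

lemma pairs_count_inj:
  assumes "m * (m - 1) div 2 = l * (l - 1) div 2" "2 \<le> (l::nat)"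
  shows "m = l"
proof -
  have *: "a * (a - 1) div 2 < b * (b - 1) div 2" if "a < b" "2 \<le> b" for a b :: nat
  proof -
    have "a * (a - 1) div 2 \<le> (b - 1) * (b - 1 - 1) div 2"
      using that by (intro div_le_mono mult_le_mono) auto
    moreover have "b * (b - 1) = (b - 1) * (b - 1 - 1) + 2 * (b - 1)"
      using that by (cases b; cases "b - 1") auto
    then have "b * (b - 1) div 2 = (b - 1) * (b - 1 - 1) div 2 + (b - 1)" by simp
    ultimately show ?thesis using that by linarith
  qed
  show ?thesis using assms *[of m l] *[of l m] by (cases m l rule: linorder_cases) auto
qed

section \<open>Arrangements with a fixed parametrization of every pseudoline\<close>

locale parametrized_arrangement =
  fixes A :: "point set set" and h g :: "point set \<Rightarrow> point \<Rightarrow> point"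
  assumes simple: "simple_pseudoline_arrangement A"
    and hg: "P \<in> A \<Longrightarrow> homeomorphism UNIV UNIV (h P) (g P)" "P \<in> A \<Longrightarrow> P = h P ` xaxis"
begin

definition crossing :: "point set \<Rightarrow> point set \<Rightarrow> point" where
  "crossing P Q = (THE p. P \<inter> Q = {p})"

definition pos :: "point set \<Rightarrow> point set \<Rightarrow> real" where
  "pos P Q = fst (g P (crossing P Q))"

text \<open>For distinct lines of \<open>A\<close>, this is the side of \<open>P\<close> on which
  \<open>Q\<close> runs before their crossing; it depends on the chosen parametrizations.\<close>

definition above :: "point set \<Rightarrow> point set \<Rightarrow> bool" where
  "above P Q \<longleftrightarrow> (\<forall>r<pos Q P. 0 < snd (g P (h Q (r, 0))))"

lemma finite_A: "finite A"
  using simple by (simp add: simple_pseudoline_arrangement_def pseudoline_arrangement_def)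

lemma crossing:
  assumes "P \<in> A" "Q \<in> A" "P \<noteq> Q"
  shows "P \<inter> Q = {crossing P Q}" "is_crossing P Q (crossing P Q)"
proof -
  have "\<forall>P\<in>A. \<forall>Q\<in>A. P \<noteq> Q \<longrightarrow> (\<exists>p. P \<inter> Q = {p} \<and> is_crossing P Q p)"
    using simple by (simp add: simple_pseudoline_arrangement_def pseudoline_arrangement_def)
  then obtain p where p: "P \<inter> Q = {p}" "is_crossing P Q p" using assms by blast
  then have "crossing P Q = p" by (simp add: crossing_def)
  then show "P \<inter> Q = {crossing P Q}" "is_crossing P Q (crossing P Q)" using p by simp_all
qed

lemma crossing_commute: "crossing P Q = crossing Q P"
  by (simp add: crossing_def Int_commute)

lemma crossing_inj:
  assumes "P \<in> A" "Q \<in> A" "R \<in> A" "S \<in> A" "P \<noteq> Q" "R \<noteq> S" "crossing P Q = crossing R S"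
  shows "{P, Q} = {R, S}"
proof (rule ccontr)
  assume ne: "{P, Q} \<noteq> {R, S}"
  have "\<forall>P\<in>A. \<forall>Q\<in>A. \<forall>R\<in>A. \<forall>S\<in>A. P \<noteq> Q \<longrightarrow> R \<noteq> S \<longrightarrow> {P, Q} \<noteq> {R, S} \<longrightarrow>
      P \<inter> Q \<noteq> R \<inter> S"
    using simple unfolding simple_pseudoline_arrangement_def by (rule conjunct2)
  note this[rule_format, OF assms(1-6) ne]
  then show False using crossing(1)[of P Q] crossing(1)[of R S] assms by simp
qed

lemma g_h [simp]: "P \<in> A \<Longrightarrow> g P (h P z) = z" and h_g [simp]: "P \<in> A \<Longrightarrow> h P (g P z) = z"
  using homeomorphismD(1,2)[OF hg(1)] by auto

lemma h_fst_g:
  assumes "P \<in> A" "z \<in> P"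
  shows "h P (fst (g P z), 0) = z"
proof -
  obtain y where y: "y \<in> xaxis" "z = h P y" using hg(2) assms by blast
  then have "(fst y, 0) = y" by (simp add: xaxis_def prod_eq_iff)
  then show ?thesis using y assms by simp
qed

lemma h_pos:
  assumes "P \<in> A" "Q \<in> A" "P \<noteq> Q"
  shows "h P (pos P Q, 0) = crossing P Q"
  unfolding pos_def using assms crossing(1)[OF assms] by (intro h_fst_g) auto

text \<open>The sign of \<open>snd (g P (crossing Q R))\<close> tells the side of \<open>P\<close>
  on which the crossing lies. Computing it by \<open>crossing_changes_side\<close> along
  \<open>Q\<close> and along \<open>R\<close> gives \<open>sides\<close>.\<close>

sublocale signed_lines A pos above
proof
  fix P Q R assume *: "P \<in> A" "Q \<in> A" "R \<in> A" "Q \<noteq> P" "R \<noteq> P" "Q \<noteq> R"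
  have pos_neq: "pos P Q \<noteq> pos P R"
    if "P \<in> A" "Q \<in> A" "R \<in> A" "Q \<noteq> P" "R \<noteq> P" "Q \<noteq> R" for P Q R
  proof
    assume "pos P Q = pos P R"
    then have "crossing P Q = crossing P R" using h_pos that by metis
    then show False using crossing_inj[of P Q P R] that by (auto simp: doubleton_eq_iff)
  qed
  then show "pos P Q \<noteq> pos P R" using * .
  have side: "0 < snd (g P (crossing Q R)) \<longleftrightarrow> (pos Q R < pos Q P \<longleftrightarrow> above P Q)"
    if "P \<in> A" "Q \<in> A" "R \<in> A" "Q \<noteq> P" "R \<noteq> P" "Q \<noteq> R" for P Q R
  proof -
    have hq: "h Q (pos Q P, 0) = crossing P Q" using h_pos[of Q P] that by (simp add: crossing_commute[of P Q])
    have "pos Q R \<noteq> pos Q P" using pos_neq[of Q R P] that by auto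
    then show ?thesis
      using crossing_changes_side[of P Q "h Q" "pos Q P" "h P" "g P" "g Q" "pos Q R"]
        crossing[of P Q] hg that by (simp add: hq h_pos above_def)
  qed
  show "(pos Q R < pos Q P \<longleftrightarrow> above P Q) \<longleftrightarrow> (pos R Q < pos R P \<longleftrightarrow> above P R)"
    using side[of P Q R] side[of P R Q] * crossing_commute[of Q R] by simp
qed

lemma pa_vertices_eq: "pa_vertices A = {crossing P Q | P Q. P \<in> A \<and> Q \<in> A \<and> P \<noteq> Q}"
proof (intro equalityI subsetI)
  fix v assume "v \<in> pa_vertices A"
  then obtain P Q where PQ: "P \<in> A" "Q \<in> A" "P \<noteq> Q" "v \<in> P \<inter> Q"
    unfolding pa_vertices_def by blast
  then have "v = crossing P Q" using crossing(1)[of P Q] by simp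
  then show "v \<in> {crossing P Q | P Q. P \<in> A \<and> Q \<in> A \<and> P \<noteq> Q}" using PQ by blast
next
  fix v assume "v \<in> {crossing P Q | P Q. P \<in> A \<and> Q \<in> A \<and> P \<noteq> Q}"
  then obtain P Q where PQ: "P \<in> A" "Q \<in> A" "P \<noteq> Q" "v = crossing P Q" by blast
  then have "v \<in> P \<inter> Q" using crossing(1)[of P Q] by simp
  then show "v \<in> pa_vertices A" unfolding pa_vertices_def using PQ by blast
qed

lemma crossing_on_line:
  assumes "P \<in> A" "Q \<in> A" "R \<in> A" "P \<noteq> Q" "crossing P Q \<in> R"
  shows "R \<in> {P, Q}"
proof (rule ccontr)
  assume R: "R \<notin> {P, Q}"
  have "crossing P Q \<in> R \<inter> P" using crossing(1)[of P Q] assms by blast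
  moreover have "R \<inter> P = {crossing R P}" using crossing(1)[of R P] assms R by simp
  ultimately have "crossing R P = crossing P Q" by simp
  then have "{R, P} = {P, Q}" using crossing_inj[of R P P Q] assms R by simp
  then show False using R by blast
qed

text \<open>The numbered lines give a linear order of the crossings, and \<iota> is the index of a
  vertex in it. Along each line this order agrees with the coordinate up to reversal, so consecutive
  vertices become consecutive in the wiring diagram.\<close>

lemma ex_crossing_sequence:
  assumes "card (pa_vertices A) = l * (l - 1) div 2" "2 \<le> l"
  shows "\<exists>p es \<iota>. crossing_sequence l p es \<and> bij_betw \<iota> (pa_vertices A) {..<length es} \<and>
    (\<forall>u v. pa_adj A u v \<longrightarrow> wire_consecutive (crossing_sequence.diagram l es) (\<iota> u) (\<iota> v) \<or>
      wire_consecutive (crossing_sequence.diagram l es) (\<iota> v) (\<iota> u))"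
proof -
  obtain f flip where f: "bij_betw f {..<card A} A"
    and seq: "local_sequences (card A) (\<lambda>i j. if flip (f i) then - pos (f i) (f j) else pos (f i) (f j))"
    using ex_oriented_numbering[OF finite_A] by blast
  define p where "p i j = (if flip (f i) then - pos (f i) (f j) else pos (f i) (f j))" for i j
  define m where "m = card A"
  have seq: "local_sequences m p" using seq unfolding p_def m_def .
  obtain es where es: "distinct es" "set es = line_pairs m" "sorted_wrt (\<lambda>e f. \<not> precedes p f e) es"
    using ex_linear_extension[OF seq] by blast
  interpret cs: crossing_sequence m p es
    using seq es by (simp add: crossing_sequence_def crossing_sequence_axioms_def)
  have fA: "f i \<in> A" if "i < m" for i using f that by (auto simp: bij_betw_def m_def)
  have f_eq: "f i = f j \<longleftrightarrow> i = j" if "i < m" "j < m" for i j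
    using f that by (auto simp: bij_betw_def m_def inj_on_eq_iff)
  have f_surj: "\<exists>i<m. P = f i" if "P \<in> A" for P using f that by (auto simp: bij_betw_def m_def)
  define c where "c e = crossing (f (Min e)) (f (Max e))" for e
  have c: "c {a, b} = crossing (f a) (f b)" for a b
    by (cases "a \<le> b") (auto simp: c_def min_def max_def crossing_commute)
  have c_inj: "inj_on c (line_pairs m)"
  proof (rule inj_onI)
    fix e e' assume e: "e \<in> line_pairs m" "e' \<in> line_pairs m" "c e = c e'"
    obtain i j where ij: "e = {i, j}" "i < j" "j < m" using e(1) by (rule line_pairsE)
    obtain i' j' where ij': "e' = {i', j'}" "i' < j'" "j' < m" using e(2) by (rule line_pairsE)
    have "f ` {i, j} = f ` {i', j'}"
      using crossing_inj[of "f i" "f j" "f i'" "f j'"] e(3) ij ij' fA f_eq by (simp add: c)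
    moreover have "inj_on f {..<m}" using f by (simp add: bij_betw_def m_def)
    ultimately show "e = e'"
      using ij ij' inj_on_image_eq_iff[of f "{..<m}" "{i, j}" "{i', j'}"] by auto
  qed
  have c_img: "c ` line_pairs m = pa_vertices A"
  proof (intro equalityI subsetI)
    fix v assume "v \<in> c ` line_pairs m"
    then obtain i j where "v = c {i, j}" "i < j" "j < m" by (auto simp: line_pairs_def)
    then show "v \<in> pa_vertices A"
      unfolding pa_vertices_eq using fA[of i] fA[of j] f_eq[of i j] by (auto simp: c)
  next
    fix v assume "v \<in> pa_vertices A"
    then obtain P Q where PQ: "v = crossing P Q" "P \<in> A" "Q \<in> A" "P \<noteq> Q"
      unfolding pa_vertices_eq by blast
    then obtain i j where "i < m" "j < m" "P = f i" "Q = f j" using f_surj by blast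
    then show "v \<in> c ` line_pairs m"
      using PQ by (intro image_eqI[of _ _ "{i, j}"]) (auto simp: c in_line_pairs)
  qed
  have "card (pa_vertices A) = m * (m - 1) div 2"
    using card_image[OF c_inj] by (simp add: c_img card_line_pairs)
  then have "m * (m - 1) div 2 = l * (l - 1) div 2" using assms(1) by (rule trans[OF sym])
  then have m: "m = l" using assms(2) by (rule pairs_count_inj)
  define vert where "vert k = c (es ! k)" for k
  have bij: "bij_betw vert {..<length es} (pa_vertices A)"
  proof -
    have "bij_betw (\<lambda>k. es ! k) {..<length es} (line_pairs m)"
      using es by (intro bij_betw_nth) auto
    moreover have "bij_betw c (line_pairs m) (pa_vertices A)"
      using c_inj c_img by (simp add: bij_betw_def)
    ultimately have "bij_betw (c \<circ> (\<lambda>k. es ! k)) {..<length es} (pa_vertices A)"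
      by (rule bij_betw_trans)
    then show ?thesis by (simp add: vert_def[abs_def] comp_def)
  qed
  define \<iota> where "\<iota> = inv_into {..<length es} vert"
  have \<iota>: "bij_betw \<iota> (pa_vertices A) {..<length es}"
    unfolding \<iota>_def using bij by (rule bij_betw_inv_into)
  have on_line: "a \<in> es ! k \<and> (\<exists>b<m. b \<noteq> a \<and> es ! k = {a, b} \<and> vert k = crossing (f a) (f b))"
    if k: "k < length es" and "a < m" "vert k \<in> f a" for a k
  proof -
    obtain i j where ij: "es ! k = {i, j}" "i < j" "j < m" using cs.es_nth_eq[OF k] .
    then have v: "vert k = crossing (f i) (f j)" by (simp add: vert_def c)
    have "f a \<in> {f i, f j}"
      using ij that fA f_eq[of i j] v by (intro crossing_on_line) auto
    then consider "a = i" | "a = j" using f_eq[of a i] f_eq[of a j] \<open>a < m\<close> ij by auto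
    then show ?thesis
    proof cases
      case 1
      then show ?thesis using ij v by auto
    next
      case 2
      then have "es ! k = {a, i}" "vert k = crossing (f a) (f i)"
        using ij v by (auto simp: crossing_commute)
      then show ?thesis using ij 2 by (intro conjI exI[of _ i]) auto
    qed
  qed
  have adj: "wire_consecutive cs.diagram j k"
    if jk: "j < k" "k < length es" and a: "a < m" and on: "vert j \<in> f a" "vert k \<in> f a"
      and btw: "\<And>r. r \<in> open_segment (fst (g (f a) (vert j))) (fst (g (f a) (vert k))) \<Longrightarrow>
        h (f a) (r, 0) \<notin> pa_vertices A" for j k a
  proof -
    obtain b where b: "b < m" "b \<noteq> a" "es ! j = {a, b}" "vert j = crossing (f a) (f b)"
      using on_line[of j a] jk a on by auto
    obtain d where d: "d < m" "d \<noteq> a" "es ! k = {a, d}" "vert k = crossing (f a) (f d)"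
      using on_line[of k a] jk a on by auto
    have "a \<notin> es ! i" if i: "j < i" "i < k" for i
    proof
      assume ai: "a \<in> es ! i"
      obtain x y where "es ! i = {x, y}" "x < y" "y < m" using cs.es_nth_eq[of i] i jk by auto
      moreover from this have "a = x \<or> a = y" using ai by simp
      ultimately obtain e where e: "e < m" "e \<noteq> a" "es ! i = {a, e}"
        by (metis insert_commute less_irrefl order.strict_trans)
      \<comment> \<open>A crossing of line \<open>a\<close> listed between \<open>j\<close> and
        \<open>k\<close> lies between them along \<open>f a\<close>, whether or not the line was
        reversed, which contradicts \<open>btw\<close>.\<close>
      have "p a b < p a e" "p a e < p a d"
        using cs.pos_less_iff[of j i a b e] cs.pos_less_iff[of i k a e d] b d e i jk by auto
      then have "pos (f a) (f e) \<in> open_segment (pos (f a) (f b)) (pos (f a) (f d))"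
        by (auto simp: p_def open_segment_eq_real_ivl split: if_splits)
      then have "h (f a) (pos (f a) (f e), 0) \<notin> pa_vertices A"
        using btw by (simp add: b d pos_def)
      moreover have "h (f a) (pos (f a) (f e), 0) = crossing (f a) (f e)"
        using a e fA f_eq by (intro h_pos) auto
      moreover have "f a \<in> A" "f e \<in> A" "f a \<noteq> f e" using a e fA f_eq by auto
      then have "crossing (f a) (f e) \<in> pa_vertices A" unfolding pa_vertices_eq by blast
      ultimately show False by simp
    qed
    then show ?thesis using cs.wire_consecutive_diagram[OF jk, of a] b d by auto
  qed
  have cons: "wire_consecutive cs.diagram (\<iota> u) (\<iota> v) \<or> wire_consecutive cs.diagram (\<iota> v) (\<iota> u)"
    if uv: "u \<in> pa_vertices A" "v \<in> pa_vertices A" "u \<noteq> v" and P: "P \<in> A" "consecutive_on A P u v"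
    for u v P
  proof -
    obtain a where a: "a < m" "P = f a" using f_surj P(1) by blast
    note par = consecutive_on_parametrization[OF P(2) hg[OF P(1)]]
    have i: "vert (\<iota> u) = u" "vert (\<iota> v) = v" "\<iota> u < length es" "\<iota> v < length es"
      using uv bij \<iota> by (auto simp: \<iota>_def bij_betw_inv_into_right bij_betw_def)
    then have "\<iota> u \<noteq> \<iota> v" using uv(3) by metis
    then consider "\<iota> u < \<iota> v" | "\<iota> v < \<iota> u" by linarith
    then show ?thesis
    proof cases
      case 1
      then show ?thesis using adj[of "\<iota> u" "\<iota> v" a] par a i by auto
    next
      case 2
      then show ?thesis using adj[of "\<iota> v" "\<iota> u" a] par a i by (auto simp: open_segment_commute)
    qed
  qed
  show ?thesis
  proof (intro exI conjI allI impI)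
    show "crossing_sequence l p es" using cs.crossing_sequence_axioms m by simp
    show "bij_betw \<iota> (pa_vertices A) {..<length es}" by (fact \<iota>)
    fix u v assume "pa_adj A u v"
    then show "wire_consecutive (crossing_sequence.diagram l es) (\<iota> u) (\<iota> v) \<or>
      wire_consecutive (crossing_sequence.diagram l es) (\<iota> v) (\<iota> u)"
      unfolding pa_adj_def using cons[of u v] cons[of v u] m by blast
  qed
qed

end

section \<open>Assembling the drawing on the grid\<close>

lemma ex_parametrized_arrangement:
  assumes "simple_pseudoline_arrangement A"
  obtains h g where "parametrized_arrangement A h g"
proof -
  have "\<forall>P\<in>A. \<exists>h g. homeomorphism UNIV UNIV h g \<and> P = h ` xaxis"
    using assms
    by (simp add: simple_pseudoline_arrangement_def pseudoline_arrangement_def pseudoline_def)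
  then obtain h g where "\<forall>P\<in>A. homeomorphism UNIV UNIV (h P) (g P) \<and> P = h P ` xaxis"
    by metis
  then have "parametrized_arrangement A h g"
    using assms by (auto simp: parametrized_arrangement_def)
  then show thesis by (rule that)
qed

text \<open>Level \<open>i\<close> of a wiring diagram is given weight \<open>level_size w i div l + 1\<close>; these weights sum
  to at most \<open>2 * l\<close>, so the levels fit into the rows of the grid.\<close>
lemma ex_grid_drawing:
  assumes w: "wiring_diagram l w" and len: "length w = l * (l - 1) div 2" and l: "3 \<le> l"
  obtains X Y :: "nat \<Rightarrow> nat" where "level_drawing w (\<lambda>k. real (X k)) (\<lambda>i. real (Y i))"
    "\<And>k. k < length w \<Longrightarrow> (X k, Y (w ! k)) \<in> grid_points l (kappa_max l)"
proof -
  define a where "a i = level_size w i div l + 1" for i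
  have w_lt: "w ! k < l - 1" if "k < length w" for k
    using w that by (auto simp: wiring_diagram_def less_diff_conv)
  obtain Y where Y_less: "\<And>i j. \<lbrakk>i < j; j < l - 1\<rbrakk> \<Longrightarrow> Y i < Y j"
    and Y_le: "\<And>i. i < l - 1 \<Longrightarrow> 1 \<le> Y i \<and> Y i \<le> (\<Sum>i<l - 1. a i)"
    and Y_dvd: "\<And>i. i < l - 1 \<Longrightarrow> \<exists>k. 2 ^ k dvd Y i \<and> a i < 2 ^ Suc k"
    using ex_universal_rows[of "l - 1" a] by (auto simp: a_def)
  have "l * (\<Sum>i<l - 1. a i) = (\<Sum>i<l - 1. l * (level_size w i div l)) + l * (l - 1)"
    by (simp add: a_def sum.distrib sum_distrib_left distrib_left)
  also have "\<dots> \<le> (\<Sum>i<l - 1. level_size w i) + l * (l - 1)"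
    by (intro add_right_mono sum_mono) simp
  also have "\<dots> \<le> l * l + l * l"
    unfolding sum_level_size[OF w] len
    by (intro add_mono) (auto intro: order_trans[OF div_le_dividend])
  also have "\<dots> = l * (2 * l)" by simp
  finally have sum_le: "(\<Sum>i<l - 1. a i) \<le> 2 * l" using l by (simp only: nat_mult_le_cancel1)
  \<comment> \<open>The rank of crossing \<open>k\<close> within its level, counted from
    \<open>1\<close>: each row is filled from the left without gaps.\<close>
  define X where "X k = card {j. j \<le> k \<and> w ! j = w ! k}" for k
  have X1: "1 \<le> X k" for k
  proof -
    have "k \<in> {j. j \<le> k \<and> w ! j = w ! k}" by simp
    moreover have "finite {j. j \<le> k \<and> w ! j = w ! k}" by simp
    ultimately show ?thesis unfolding X_def by (metis One_nat_def Suc_leI card_gt_0_iff empty_iff)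
  qed
  have X_less: "X j < X k" if "j < k" "w ! j = w ! k" for j k
    unfolding X_def
  proof (rule psubset_card_mono)
    have "k \<in> {i. i \<le> k \<and> w ! i = w ! k}" "k \<notin> {i. i \<le> j \<and> w ! i = w ! j}" using that by auto
    moreover have "{i. i \<le> j \<and> w ! i = w ! j} \<subseteq> {i. i \<le> k \<and> w ! i = w ! k}" using that by auto
    ultimately show "{i. i \<le> j \<and> w ! i = w ! j} \<subset> {i. i \<le> k \<and> w ! i = w ! k}" by blast
  qed simp
  have X_le: "X k \<le> level_size w (w ! k)" if "k < length w" for k
    unfolding X_def level_size_def using that by (intro card_mono) auto
  have "level_drawing w (\<lambda>k. real (X k)) (\<lambda>i. real (Y i))"
  proof
    show "real (X j) < real (X k)" if "j < k" "k < length w" "w ! j = w ! k" for j k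
      using X_less that by simp
    show "real (Y i) < real (Y j)" if "i \<in> set w" "j \<in> set w" "i < j" for i j
      using Y_less[of i j] w_lt that by (auto simp: in_set_conv_nth)
  qed
  moreover have "(X k, Y (w ! k)) \<in> grid_points l (kappa_max l)" if k: "k < length w" for k
  proof -
    obtain e where e: "2 ^ e dvd Y (w ! k)" "a (w ! k) < 2 ^ Suc e" using Y_dvd w_lt k by blast
    \<comment> \<open>A quotient by \<open>l\<close>, increased by one and multiplied by
      \<open>l\<close>, exceeds the dividend; so the row is long enough for its level.\<close>
    have "level_size w (w ! k) < a (w ! k) * l"
      unfolding a_def using l by (metis Suc_eq_plus1 dividend_less_div_times add.commute mult_Suc
        not_numeral_le_zero gr0I)
    also have "\<dots> \<le> 2 ^ Suc e * l" using e(2) by (intro mult_le_mono1) simp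
    finally have "X k < 2 ^ Suc e * l" using X_le[OF k] by simp
    moreover have "X k \<le> kappa_max l"
      using X_le[OF k] level_size_le_kappa_max[OF w w_lt[OF k]] by simp
    ultimately show ?thesis
      using X1 Y_le[of "w ! k"] w_lt[OF k] sum_le e(1) by (auto simp: grid_points_def)
  qed
  ultimately show thesis by (rule that)
qed

lemma ex_universal_drawing:
  assumes A: "simple_pseudoline_arrangement A" and card: "card (pa_vertices A) = l * (l - 1) div 2"
    and l: "3 \<le> l"
  shows "\<exists>d. straight_line_drawing (pa_vertices A) (pa_adj A) d \<and>
    d ` pa_vertices A \<subseteq> (\<lambda>(x, y). (real x, real y)) ` grid_points l (kappa_max l)"
proof -
  obtain h g where "parametrized_arrangement A h g" using ex_parametrized_arrangement[OF A] .
  then interpret parametrized_arrangement A h g .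
  have l2: "2 \<le> l" using l by simp
  obtain p es \<iota> where cs: "crossing_sequence l p es"
    and \<iota>: "bij_betw \<iota> (pa_vertices A) {..<length es}"
    and adj: "\<And>u v. pa_adj A u v \<Longrightarrow> wire_consecutive (crossing_sequence.diagram l es) (\<iota> u) (\<iota> v) \<or>
      wire_consecutive (crossing_sequence.diagram l es) (\<iota> v) (\<iota> u)"
    using ex_crossing_sequence[OF card l2] by (elim exE conjE) auto
  interpret cs: crossing_sequence l p es by (fact cs)
  have "length cs.diagram = l * (l - 1) div 2"
    using distinct_card[OF cs.distinct_es] by (simp add: cs.set_es card_line_pairs)
  then obtain X Y where ld: "level_drawing cs.diagram (\<lambda>k. real (X k)) (\<lambda>i. real (Y i))"
    and grid: "\<And>k. k < length cs.diagram \<Longrightarrow>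
      (X k, Y (cs.diagram ! k)) \<in> grid_points l (kappa_max l)"
    using ex_grid_drawing[OF cs.wiring_diagram_diagram _ l] by blast
  interpret ld: level_drawing cs.diagram "\<lambda>k. real (X k)" "\<lambda>i. real (Y i)" by (fact ld)
  have "straight_line_drawing (pa_vertices A) (pa_adj A) (ld.place \<circ> \<iota>)"
  proof (rule straight_line_drawing_comp[OF ld.straight_line_drawing_place])
    show "inj_on \<iota> (pa_vertices A)" "\<iota> ` pa_vertices A \<subseteq> {..<length cs.diagram}"
      using \<iota> by (auto simp: bij_betw_def)
    show "u \<in> pa_vertices A \<and> v \<in> pa_vertices A \<and> ld.edge (\<iota> u) (\<iota> v)" if "pa_adj A u v" for u v
      using adj[OF that] that by (auto simp: pa_adj_def ld.edge_def)
  qed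
  moreover have "(ld.place \<circ> \<iota>) ` pa_vertices A \<subseteq>
      (\<lambda>(x, y). (real x, real y)) ` grid_points l (kappa_max l)"
  proof
    fix z assume "z \<in> (ld.place \<circ> \<iota>) ` pa_vertices A"
    then obtain v where "v \<in> pa_vertices A" "z = ld.place (\<iota> v)" by auto
    moreover from this have "\<iota> v < length cs.diagram" using \<iota> by (auto simp: bij_betw_def)
    ultimately show "z \<in> (\<lambda>(x, y). (real x, real y)) ` grid_points l (kappa_max l)"
      using grid[of "\<iota> v"] by (force simp: ld.place_def)
  qed
  ultimately show ?thesis by blast
qed

theorem theorem3:
  shows "\<exists>C::real. C > 0 \<and>
    (\<forall>l::nat. l \<ge> 3 \<longrightarrow>
      (let n = l * (l - 1) div 2 in
        \<exists>U :: point set. finite U \<and> real (card U) \<le> C * real n * ln (real n) \<and>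
          (\<forall>p\<in>U. \<exists>x y :: int. p = (real_of_int x, real_of_int y) \<and>
              1 \<le> x \<and> x \<le> int (kappa_max l) \<and> 1 \<le> y \<and> real_of_int y \<le> C * real l) \<and>
          (\<forall>A. simple_pseudoline_arrangement A \<and> card (pa_vertices A) = n \<longrightarrow>
              (\<exists>d. straight_line_drawing (pa_vertices A) (pa_adj A) d \<and>
                   d ` pa_vertices A \<subseteq> U))))"
\<comment> \<open>The value \<open>48\<close> is forced by the count in
  \<open>card_grid_points_le\<close>; it also covers the height \<open>2 * l\<close> of the
  grid.\<close>
proof (intro exI[of _ 48] conjI allI impI)
  fix l :: nat assume l: "3 \<le> l"
  define n where "n = l * (l - 1) div 2"
  define U where "U = (\<lambda>(x, y). (real x, real y)) ` grid_points l (kappa_max l)"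
  show "let n = l * (l - 1) div 2 in
        \<exists>U :: point set. finite U \<and> real (card U) \<le> 48 * real n * ln (real n) \<and>
          (\<forall>p\<in>U. \<exists>x y :: int. p = (real_of_int x, real_of_int y) \<and>
              1 \<le> x \<and> x \<le> int (kappa_max l) \<and> 1 \<le> y \<and> real_of_int y \<le> 48 * real l) \<and>
          (\<forall>A. simple_pseudoline_arrangement A \<and> card (pa_vertices A) = n \<longrightarrow>
              (\<exists>d. straight_line_drawing (pa_vertices A) (pa_adj A) d \<and>
                   d ` pa_vertices A \<subseteq> U))"
    unfolding Let_def n_def[symmetric]
  proof (rule exI[of _ U], intro conjI ballI allI impI)
    show "finite U" unfolding U_def using finite_grid_points by blast
    show "real (card U) \<le> 48 * real n * ln (real n)"
      using card_image_le[OF finite_grid_points] card_grid_points_le[OF l n_def]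
      unfolding U_def by (meson of_nat_mono order_trans)
  next
    fix p assume "p \<in> U"
    then obtain x y where "p = (real x, real y)" "(x, y) \<in> grid_points l (kappa_max l)"
      by (auto simp: U_def)
    then show "\<exists>x y :: int. p = (real_of_int x, real_of_int y) \<and>
        1 \<le> x \<and> x \<le> int (kappa_max l) \<and> 1 \<le> y \<and> real_of_int y \<le> 48 * real l"
      by (intro exI[of _ "int x"] exI[of _ "int y"]) (auto simp: grid_points_def)
  next
    fix A assume "simple_pseudoline_arrangement A \<and> card (pa_vertices A) = n"
    then show "\<exists>d. straight_line_drawing (pa_vertices A) (pa_adj A) d \<and> d ` pa_vertices A \<subseteq> U"
      using ex_universal_drawing[of A l] l by (simp add: U_def n_def)
  qed
qed simp

end
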